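(* Let $\mathcal{S}=\{S_k\}_{k\in\mathbb{N}_0}$ be a subdivision scheme belonging to class B (with the data $p,q,D,\pi_k,\vec\Lambda_0,\vec\Lambda_1,\rho,C$ described in the context) such that $$\langle\vec\Lambda_l(\pi),(1,\ldots,1)\rangle=1,\qquad\forall\pi\in D,\ l=0,1.$$ Then $\mathcal{S}$ reproduces constants. In addition, if the associated linear scheme $\mathcal{S}^*$ is $\mathcal{C}^1$, then $\mathcal{S}$ is $\mathcal{C}^1$.
   Context: Notation: $\mathbb{N}_0=\{0,1,2,\ldots\}$, $\mathbb{N}=\{1,2,\ldots\}$; $\ell_\infty(\mathbb{Z},\mathbb{R}^n)$ is the set of bounded sequences $f=(f_i)_{i\in\mathbb{Z}}$, $f_i\in\mathbb{R}^n$. For $a=(a_j)$ real and $b=(b_j)$ with $b_j\in\mathbb{R}^m$, of equal finite length, $\langle a,b\rangle:=\sum_j a_jb_j\in\mathbb{R}^m$. Subdivision schemes: a uniform subdivision scheme is a sequence $\mathcal{S}=\{S_k\}_{k\in\mathbb{N}_0}$ of operators $S_k:\ell_\infty(\mathbb{Z},\mathbb{R}^n)\to\ell_\infty(\mathbb{Z},\mathbb{R}^n)$ of the form $(S_kf)_{2i+l}=\Psi^k_l(f_{i-p},\ldots,f_{i+p+1})$, $l=0,1$, $i\in\mathbb{Z}$, for some $p\in\mathbb{N}_0$ and $\Psi^k_0,\Psi^k_1:(\mathbb{R}^n)^{2p+2}\to\mathbb{R}^n$; it is linear if all $\Psi^k_l$ are linear and stationary if the $\Psi^k_l$ do not depend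 on $k$. Convergence: $\{f^k\}$ converges uniformly to a continuous $G:\mathbb{R}\to\mathbb{R}^n$ iff for every compact interval $I\subset\mathbb{R}$, $\lim_{k\to\infty}\sup_{i\in\mathbb{Z}\cap2^kI}|f^k_i-G(i2^{-k})|=0$. A scheme is convergent iff for every $f^0\in\ell_\infty(\mathbb{Z},\mathbb{R}^n)$ the sequence $f^{k+1}=S_kf^k$ converges uniformly to a continuous function $S^\infty f^0$, and $S^\infty\ne0$. It is $\mathcal{C}^1$ iff it is convergent and $S^\infty f^0\in\mathcal{C}^1(\mathbb{R},\mathbb{R}^n)$ for all $f^0$. Class B: $\mathcal{S}$ belongs to class B iff it is uniform and there exist $q\in\mathbb{N}$, $D\subset\mathbb{R}^q$ with $0\in D$, maps $\pi_k:(\mathbb{R}^n)^{2p+2}\to D$ ($k\in\mathbb{N}_0$), $\vec\Lambda_0,\vec\Lambda_1:D\to\mathbb{R}^{2p+2}$ and $\rho,C>0$ such that, for some norms $|\cdot|_{\mathbb{R}^q},|\cdot|_{\mathbb{R}^{2p+2}}$, for $l=0,1$, all $k\in\mathbb{N}_0$ and all $f_{-p},\ldots,f_{p+1}\in\mathbb{R}^n$, $$\Psi^k_l(f_{-p},\ldots,f_{p+1})=\langle\vec\Lambda_l(\pi_k(f_{-p},\ldots,f_{p+1})),(f_{-p},\ldots,f_{p+1})\rangle,$$ $$|\pi_k(f_{-p},\ldots,f_{p+1})|_{\mathbb{R}^q}\le2^{-k}\rho,\qquad|\vec\Lambda_l(\pi)-\vec\Lambda_l(0)|_{\mathbb{R}^{2p+2}}\le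 C|\pi|_{\mathbb{R}^q}\ \ \forall\pi\in D;$$ moreover it is required that the linear uniform stationary scheme $\mathcal{S}^*$ with rules $\Psi^*_l(f_{-p},\ldots,f_{p+1})=\langle\vec\Lambda_l(0),(f_{-p},\ldots,f_{p+1})\rangle$, $l=0,1$, is convergent. $\mathcal{S}$ reproduces constants means: for every $c\in\mathbb{R}^n$, if $f^0_i=c$ for all $i\in\mathbb{Z}$, then $f^{k+1}=S_kf^k$ satisfies $f^k=f^0$ for all $k\in\mathbb{N}_0$. *)

theory Defs
  imports "HOL-Analysis.Analysis" "Jordan_Normal_Form.Matrix"
begin

text \<open>
  The control points live in \<open>real^'n\<close>. The dimensions \<open>q\<close> and \<open>2p + 2\<close> are numbers rather
  than types, so elements of \<open>R^q\<close>, \<open>R^(2p+2)\<close> and \<open>(R^n)^(2p+2)\<close> are vectors of type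
  \<open>_ Matrix.vec\<close> in the carriers \<open>carrier_vec q\<close> and \<open>carrier_vec (2 * p + 2)\<close>. Entry \<open>j\<close> of a
  vector of length \<open>2p + 2\<close> is the one with index \<open>j - p\<close> in \<open>{-p, ..., p + 1}\<close>.
\<close>

definition linf :: "(int \<Rightarrow> real^'n) set" where
  "linf = {f. bounded (range f)}"

definition pairing :: "real Matrix.vec \<Rightarrow> ('b::real_vector) Matrix.vec \<Rightarrow> 'b" where
  "pairing a b = (\<Sum>j<dim_vec a. vec_index a j *\<^sub>R vec_index b j)"

definition is_norm_on :: "nat \<Rightarrow> (real Matrix.vec \<Rightarrow> real) \<Rightarrow> bool" where
  "is_norm_on m N \<longleftrightarrow>
     (\<forall>v\<in>carrier_vec m. 0 \<le> N v \<and> (N v = 0 \<longleftrightarrow> v = 0\<^sub>v m)) \<and>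
     (\<forall>c. \<forall>v\<in>carrier_vec m. N (c \<cdot>\<^sub>v v) = \<bar>c\<bar> * N v) \<and>
     (\<forall>v\<in>carrier_vec m. \<forall>w\<in>carrier_vec m. N (v + w) \<le> N v + N w)"


subsection \<open>Uniform subdivision schemes\<close>

text \<open>The stencil \<open>(f (i - p), ..., f (i + p + 1))\<close>.\<close>

definition window :: "nat \<Rightarrow> (int \<Rightarrow> real^'n) \<Rightarrow> int \<Rightarrow> (real^'n) Matrix.vec" where
  "window p f i = Matrix.vec (2 * p + 2) (\<lambda>j. f (i - int p + int j))"

text \<open>Operators are total functions in HOL; only their values on \<open>linf\<close> are meaningful.\<close>

definition uniform_scheme ::
    "nat \<Rightarrow> (nat \<Rightarrow> nat \<Rightarrow> (real^'n) Matrix.vec \<Rightarrow> real^'n) \<Rightarrow>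
     (nat \<Rightarrow> (int \<Rightarrow> real^'n) \<Rightarrow> int \<Rightarrow> real^'n) \<Rightarrow> bool" where
  "uniform_scheme p \<Psi> S \<longleftrightarrow>
     (\<forall>k. \<forall>f\<in>linf. S k f \<in> linf \<and>
        (\<forall>i. \<forall>l<2. S k f (2 * i + int l) = \<Psi> k l (window p f i)))"

text \<open>The linear stationary scheme with coefficient vectors \<open>a 0\<close> and \<open>a 1\<close>.\<close>

definition linear_scheme ::
    "nat \<Rightarrow> (nat \<Rightarrow> real Matrix.vec) \<Rightarrow> nat \<Rightarrow> (int \<Rightarrow> real^'n) \<Rightarrow> int \<Rightarrow> real^'n" where
  "linear_scheme p a k f j = pairing (a (nat (j mod 2))) (window p f (j div 2))"

lemma uniform_scheme_linear_scheme:
  assumes "\<And>l. l < 2 \<Longrightarrow> a l \<in> carrier_vec (2 * p + 2)"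
  shows "uniform_scheme p (\<lambda>k l. pairing (a l))
           (linear_scheme p a :: nat \<Rightarrow> (int \<Rightarrow> real^'n) \<Rightarrow> int \<Rightarrow> real^'n)"
  unfolding uniform_scheme_def
proof (intro allI ballI conjI impI)
  fix k :: nat and f :: "int \<Rightarrow> real^'n" and i :: int and l :: nat
  assume "l < 2"
  then have "l = 0 \<or> l = 1" by auto
  then show "linear_scheme p a k f (2 * i + int l) = pairing (a l) (window p f i)"
    by (auto simp: linear_scheme_def)
next
  fix k :: nat and f :: "int \<Rightarrow> real^'n"
  assume "f \<in> linf"
  then obtain B where B: "\<And>i. norm (f i) \<le> B"
    by (auto simp: linf_def bounded_iff)
  let ?A = "\<lambda>l. \<Sum>j<2 * p + 2. \<bar>vec_index (a l) j\<bar> * B"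
  have "norm (linear_scheme p a k f j) \<le> max (?A 0) (?A 1)" for j
  proof -
    let ?l = "nat (j mod 2)"
    have l: "?l = 0 \<or> ?l = 1" by auto
    then have "a ?l \<in> carrier_vec (2 * p + 2)" using assms by auto
    then have "linear_scheme p a k f j =
        (\<Sum>i<2 * p + 2. vec_index (a ?l) i *\<^sub>R f (j div 2 - int p + int i))"
      unfolding linear_scheme_def pairing_def window_def by (intro sum.cong) auto
    also have "norm \<dots> \<le> ?A ?l"
      by (intro order_trans[OF norm_sum] sum_mono) (simp add: B mult_left_mono)
    also have "\<dots> \<le> max (?A 0) (?A 1)"
      using l by (elim disjE) (simp_all only: max.cobounded1 max.cobounded2)
    finally show ?thesis .
  qed
  then show "linear_scheme p a k f \<in> linf"
    unfolding linf_def bounded_iff by blast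
qed


subsection \<open>Convergence and smoothness\<close>

primrec iterates :: "(nat \<Rightarrow> (int \<Rightarrow> real^'n) \<Rightarrow> int \<Rightarrow> real^'n) \<Rightarrow> (int \<Rightarrow> real^'n) \<Rightarrow>
    nat \<Rightarrow> int \<Rightarrow> real^'n" where
  "iterates S f 0 = f"
| "iterates S f (Suc k) = S k (iterates S f k)"

text \<open>
  The supremum is taken in \<open>[0, \<infinity>]\<close>, so that it is 0 when no integer lies in \<open>2^k I\<close>; the
  supremum of the empty set of reals is unspecified in HOL.
\<close>

definition converges_uniformly :: "(nat \<Rightarrow> int \<Rightarrow> real^'n) \<Rightarrow> (real \<Rightarrow> real^'n) \<Rightarrow> bool" where
  "converges_uniformly fs G \<longleftrightarrow>
     (\<forall>a b. a \<le> b \<longrightarrow>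
        (\<lambda>k. SUP i\<in>{i. real_of_int i \<in> (\<lambda>x. 2 ^ k * x) ` {a..b}}.
               ennreal (norm (fs k i - G (real_of_int i / 2 ^ k)))) \<longlonglongrightarrow> 0)"

text \<open>
  The limit function of a subdivision process is treated as a relation; it is unique, because
  a continuous function is determined by its values at the dyadic points.
\<close>

definition limit_function ::
    "(nat \<Rightarrow> (int \<Rightarrow> real^'n) \<Rightarrow> int \<Rightarrow> real^'n) \<Rightarrow> (int \<Rightarrow> real^'n) \<Rightarrow>
     (real \<Rightarrow> real^'n) \<Rightarrow> bool" where
  "limit_function S f G \<longleftrightarrow> continuous_on UNIV G \<and> converges_uniformly (iterates S f) G"

definition convergent_scheme :: "(nat \<Rightarrow> (int \<Rightarrow> real^'n) \<Rightarrow> int \<Rightarrow> real^'n) \<Rightarrow> bool" where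
  "convergent_scheme S \<longleftrightarrow>
     (\<forall>f\<in>linf. \<exists>G. limit_function S f G) \<and>
     (\<exists>f\<in>linf. \<exists>G. limit_function S f G \<and> G \<noteq> (\<lambda>x. 0))"

definition C1_scheme :: "(nat \<Rightarrow> (int \<Rightarrow> real^'n) \<Rightarrow> int \<Rightarrow> real^'n) \<Rightarrow> bool" where
  "C1_scheme S \<longleftrightarrow>
     convergent_scheme S \<and>
     (\<forall>f\<in>linf. \<forall>G. limit_function S f G \<longrightarrow> G C1_differentiable_on UNIV)"

definition reproduces_constants :: "(nat \<Rightarrow> (int \<Rightarrow> real^'n) \<Rightarrow> int \<Rightarrow> real^'n) \<Rightarrow> bool" where
  "reproduces_constants S \<longleftrightarrow> (\<forall>c k. iterates S (\<lambda>i. c) k = (\<lambda>i. c))"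


subsection \<open>Class B\<close>

definition class_B ::
    "nat \<Rightarrow> (nat \<Rightarrow> nat \<Rightarrow> (real^'n) Matrix.vec \<Rightarrow> real^'n) \<Rightarrow>
     nat \<Rightarrow> real Matrix.vec set \<Rightarrow> (nat \<Rightarrow> (real^'n) Matrix.vec \<Rightarrow> real Matrix.vec) \<Rightarrow>
     (nat \<Rightarrow> real Matrix.vec \<Rightarrow> real Matrix.vec) \<Rightarrow> real \<Rightarrow> real \<Rightarrow>
     (nat \<Rightarrow> (int \<Rightarrow> real^'n) \<Rightarrow> int \<Rightarrow> real^'n) \<Rightarrow> bool" where
  "class_B p \<Psi> q D \<pi> \<Lambda> \<rho> C S \<longleftrightarrow>
     uniform_scheme p \<Psi> S \<and>
     1 \<le> q \<and> D \<subseteq> carrier_vec q \<and> 0\<^sub>v q \<in> D \<and>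
     (\<forall>k. \<forall>v\<in>carrier_vec (2 * p + 2). \<pi> k v \<in> D) \<and>
     (\<forall>l<2. \<forall>x\<in>D. \<Lambda> l x \<in> carrier_vec (2 * p + 2)) \<and>
     0 < \<rho> \<and> 0 < C \<and>
     (\<exists>Nq Nm. is_norm_on q Nq \<and> is_norm_on (2 * p + 2) Nm \<and>
        (\<forall>l<2. \<forall>k. \<forall>v\<in>carrier_vec (2 * p + 2). \<Psi> k l v = pairing (\<Lambda> l (\<pi> k v)) v) \<and>
        (\<forall>k. \<forall>v\<in>carrier_vec (2 * p + 2). Nq (\<pi> k v) \<le> \<rho> / 2 ^ k) \<and>
        (\<forall>l<2. \<forall>x\<in>D. Nm (\<Lambda> l x - \<Lambda> l (0\<^sub>v q)) \<le> C * Nq x)) \<and>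
     convergent_scheme
       (linear_scheme p (\<lambda>l. \<Lambda> l (0\<^sub>v q)) :: nat \<Rightarrow> (int \<Rightarrow> real^'n) \<Rightarrow> int \<Rightarrow> real^'n)"

end

theory Submission
  imports Defs "HOL-Real_Asymp.Real_Asymp"
begin

text \<open>
  Write \<open>A\<close> for one round of the linear scheme, \<open>\<phi>\<close> for its basic limit function and
  \<open>jump g = sup |g (i + 1) - g i|\<close>. Since all coefficient vectors sum to one, the nonlinear scheme
  satisfies \<open>|S_k f - A f| \<le> \<kappa> 2^-k jump f\<close>. Convergence of \<open>A\<close> makes some power of it a
  contraction for \<open>jump\<close>, and a Lyapunov function then shows that the jumps of the iterates \<open>f^k\<close>
  of the nonlinear scheme are summable. The functions
  \<open>F_k x = \<Sum>j. \<phi> (2^k x - j) f^k_j\<close> satisfy, by the refinement equation for \<open>\<phi>\<close>,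
  \<open>F_(k+1) x - F_k x = \<Sum>j. \<phi> (2^(k+1) x - j) (S_k f^k - A f^k)_j\<close>; as \<open>\<phi>\<close> is \<open>C^1\<close>, these
  increments and their derivatives are bounded by multiples of \<open>jump f^k\<close>, so that \<open>F_k\<close> converges
  in \<open>C^1\<close>. Finally \<open>|f^k_n - F_k (n / 2^k)|\<close> is bounded by a multiple of \<open>jump f^k\<close>.
\<close>

subsection \<open>Jumps of bounded sequences\<close>

text \<open>A supremum of reals: bounding differences by \<open>jump g\<close> needs a bounded
  sequence, whereas \<open>jump_le\<close> only needs the index set to be nonempty.\<close>

definition jump :: "(int \<Rightarrow> 'b::real_normed_vector) \<Rightarrow> real" where
  "jump g = (SUP i. norm (g (i + 1) - g i))"

lemma bdd_above_jump:
  assumes "bounded (range g)"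
  shows "bdd_above (range (\<lambda>i::int. norm (g (i + 1) - g i)))"
proof -
  obtain B where B: "\<And>i. norm (g i) \<le> B"
    using assms by (auto simp: bounded_iff)
  have "norm (g (i + 1) - g i) \<le> B + B" for i
    by (intro order_trans[OF norm_triangle_ineq4] add_mono B)
  then show ?thesis by (auto intro!: bdd_aboveI)
qed

lemma norm_diff_Suc_le_jump: "bounded (range g) \<Longrightarrow> norm (g (i + 1) - g i) \<le> jump g"
  unfolding jump_def by (rule cSUP_upper[OF UNIV_I bdd_above_jump])

lemma jump_le: "(\<And>i. norm (g (i + 1) - g i) \<le> B) \<Longrightarrow> jump g \<le> B"
  unfolding jump_def by (rule cSUP_least) auto

lemma jump_nonneg: "bounded (range g) \<Longrightarrow> 0 \<le> jump g"
  using norm_diff_Suc_le_jump[of g 0] norm_ge_zero order_trans by blast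

lemma bounded_range_diff:
  assumes "bounded (range f)" "bounded (range g)"
  shows "bounded (range (\<lambda>i. f i - g i :: 'b::real_normed_vector))"
  using bounded_minus_comp[of f UNIV g] assms by simp

lemma jump_add_le:
  assumes "bounded (range f)" "bounded (range g)"
  shows "jump (\<lambda>i. f i + g i) \<le> jump f + jump g"
proof (rule jump_le)
  fix i
  have "norm (f (i + 1) + g (i + 1) - (f i + g i)) = norm ((f (i + 1) - f i) + (g (i + 1) - g i))"
    by (simp add: algebra_simps)
  also have "\<dots> \<le> jump f + jump g"
    by (intro order_trans[OF norm_triangle_ineq] add_mono norm_diff_Suc_le_jump assms)
  finally show "norm (f (i + 1) + g (i + 1) - (f i + g i)) \<le> jump f + jump g" .
qed

text \<open>Telescoping over unit steps. A small jump thus makes all control points seen by one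
  stencil close to each other.\<close>

lemma norm_diff_le_jump:
  assumes "bounded (range g)"
  shows "norm (g i - g j) \<le> \<bar>real_of_int (i - j)\<bar> * jump g"
proof -
  have step: "norm (g (j + int m) - g j) \<le> real m * jump g" for j m
  proof (induction m)
    case (Suc m)
    have "norm (g (j + int (Suc m)) - g j) =
        norm ((g (j + int m + 1) - g (j + int m)) + (g (j + int m) - g j))"
      by (simp add: algebra_simps)
    also have "\<dots> \<le> jump g + real m * jump g"
      by (intro order_trans[OF norm_triangle_ineq] add_mono norm_diff_Suc_le_jump assms Suc)
    finally show ?case by (simp add: algebra_simps)
  qed simp
  show ?thesis
  proof (cases "j \<le> i")
    case True
    then show ?thesis using step[of j "nat (i - j)"] by simp
  next
    case False
    then show ?thesis using step[of i "nat (j - i)"] by (simp add: norm_minus_commute)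
  qed
qed

subsection \<open>Iterating the linear scheme\<close>

text \<open>Polymorphic, because the scheme acts both on control points and on scalar kernels.\<close>

definition refine ::
    "nat \<Rightarrow> (nat \<Rightarrow> nat \<Rightarrow> real) \<Rightarrow> (int \<Rightarrow> 'b::real_vector) \<Rightarrow> int \<Rightarrow> 'b" where
  "refine p c g n = (\<Sum>t<2 * p + 2. c (nat (n mod 2)) t *\<^sub>R g (n div 2 - int p + int t))"

text \<open>The discrete counterpart of \<phi>: for large \<open>k\<close> its value at
  \<open>n\<close> will be close to \<open>\<phi> (n / 2 ^ k)\<close>.\<close>

definition impulse :: "nat \<Rightarrow> (nat \<Rightarrow> nat \<Rightarrow> real) \<Rightarrow> nat \<Rightarrow> int \<Rightarrow> real" where
  "impulse p c k = (refine p c ^^ k) (\<lambda>i. if i = 0 then 1 else 0)"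

lemma refine_add: "refine p c (\<lambda>i. f i + g i) = (\<lambda>n. refine p c f n + refine p c g n)"
  by (simp add: refine_def fun_eq_iff scaleR_right_distrib sum.distrib)

lemma refine_pow_add:
  "(refine p c ^^ k) (\<lambda>i. f i + g i) = (\<lambda>n. (refine p c ^^ k) f n + (refine p c ^^ k) g n)"
  by (induction k) (simp_all add: refine_add)

text \<open>Adding up both rules gives one crude bound for the sup norm of a round that serves even
  and odd positions alike.\<close>

definition mask_bound :: "nat \<Rightarrow> (nat \<Rightarrow> nat \<Rightarrow> real) \<Rightarrow> real" where
  "mask_bound p c = (\<Sum>t<2 * p + 2. \<bar>c 0 t\<bar> + \<bar>c (Suc 0) t\<bar>)"

lemma norm_refine_le:
  assumes "\<And>i. norm (g i) \<le> B"
  shows "norm (refine p c g n) \<le> mask_bound p c * B"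
proof -
  have B: "0 \<le> B" using assms[of 0] norm_ge_zero order_trans by blast
  have "nat (n mod 2) = 0 \<or> nat (n mod 2) = 1" by auto
  then have c: "\<bar>c (nat (n mod 2)) t\<bar> \<le> \<bar>c 0 t\<bar> + \<bar>c (Suc 0) t\<bar>" for t by auto
  show ?thesis
    unfolding refine_def mask_bound_def sum_distrib_right
    by (intro order_trans[OF norm_sum] sum_mono)
       (auto intro!: mult_mono c assms B)
qed

lemma norm_refine_pow_le:
  assumes "\<And>i. norm (g i) \<le> B"
  shows "norm ((refine p c ^^ k) g n) \<le> mask_bound p c ^ k * B"
proof (induction k arbitrary: n)
  case (Suc k)
  then show ?case using norm_refine_le[of "(refine p c ^^ k) g" "mask_bound p c ^ k * B" p c n]
    by (simp add: mult.assoc)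
qed (use assms in simp)

lemma bounded_refine_pow:
  fixes g :: "int \<Rightarrow> 'b::real_normed_vector"
  assumes "bounded (range g)"
  shows "bounded (range ((refine p c ^^ k) g))"
proof -
  obtain B where B: "\<And>i. norm (g i) \<le> B"
    using assms by (auto simp: bounded_iff)
  show ?thesis using norm_refine_pow_le[of g, OF B] unfolding bounded_iff by blast
qed

text \<open>Bounds the jump through the sup norm of the argument. It is meant for the perturbation
  terms, which are controlled in the sup norm.\<close>

lemma jump_refine_pow_le:
  assumes "\<And>i. norm (g i) \<le> B"
  shows "jump ((refine p c ^^ k) g) \<le> 2 * mask_bound p c ^ k * B"
proof (rule jump_le)
  fix i
  show "norm ((refine p c ^^ k) g (i + 1) - (refine p c ^^ k) g i) \<le> 2 * mask_bound p c ^ k * B"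
    using norm_triangle_ineq4[of "(refine p c ^^ k) g (i + 1)" "(refine p c ^^ k) g i"]
      norm_refine_pow_le[of g, OF assms, where p = p and c = c and k = k and n = "i + 1"] norm_refine_pow_le[of g, OF assms, where p = p and c = c and k = k and n = i]
    by linarith
qed

text \<open>The index set \<open>J\<close> may be enlarged so that neighbouring values share it.\<close>

lemma refine_pow_eq_sum_impulse:
  assumes "finite J"
    and "{j. \<bar>n - 2 ^ k * j\<bar> \<le> int (2 * p + 2) * (2 ^ k - 1)} \<subseteq> J"
  shows "(refine p c ^^ k) g n = (\<Sum>j\<in>J. impulse p c k (n - 2 ^ k * j) *\<^sub>R g j)"
  using assms(2)
proof (induction k arbitrary: n)
  case 0
  then have "n \<in> J" by auto
  have "(\<Sum>j\<in>J. impulse p c 0 (n - 2 ^ 0 * j) *\<^sub>R g j) = (\<Sum>j\<in>J. if j = n then g j else 0)"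
    by (intro sum.cong) (auto simp: impulse_def)
  also have "\<dots> = g n" using \<open>n \<in> J\<close> assms(1) by simp
  finally show ?case by simp
next
  case (Suc k)
  define l where "l = n mod 2"
  have l: "l = 0 \<or> l = 1" unfolding l_def by auto
  have n: "n = 2 * (n div 2) + l" unfolding l_def by simp
  \<comment> \<open>The radius \<open>r k = (2 * p + 2) * (2 ^ k - 1)\<close> solves
    \<open>r (Suc k) = 2 * r k + (2 * p + 2)\<close> with \<open>r 0 = 0\<close>. Hence the indices
    required at level \<open>k\<close> by any entry of the stencil of \<open>n\<close> are among
    those required by \<open>n\<close> at level \<open>Suc k\<close>.\<close>
  have sub: "{j. \<bar>(n div 2 - int p + int t) - 2 ^ k * j\<bar> \<le> int (2 * p + 2) * (2 ^ k - 1)} \<subseteq> J"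
    if t: "t < 2 * p + 2" for t
  proof
    fix j
    assume "j \<in> {j. \<bar>(n div 2 - int p + int t) - 2 ^ k * j\<bar> \<le> int (2 * p + 2) * (2 ^ k - 1)}"
    then have b: "\<bar>n div 2 - int p + int t - 2 ^ k * j\<bar> \<le> int (2 * p + 2) * (2 ^ k - 1)" by simp
    have aux: "\<bar>2 * x + y\<bar> \<le> 2 * a + b" if "\<bar>x\<bar> \<le> a" "\<bar>y\<bar> \<le> b" for x y a b :: int
      using that by linarith
    have "n - 2 ^ Suc k * j = 2 * (n div 2 - int p + int t - 2 ^ k * j) + (l + 2 * int p - 2 * int t)"
      using n by (simp add: algebra_simps)
    moreover have "\<bar>l + 2 * int p - 2 * int t\<bar> \<le> int (2 * p + 2)"
      using t l by auto
    moreover have "int (2 * p + 2) * (2 ^ Suc k - 1) = 2 * (int (2 * p + 2) * (2 ^ k - 1)) + int (2 * p + 2)"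
      by (simp add: algebra_simps)
    ultimately have "\<bar>n - 2 ^ Suc k * j\<bar> \<le> int (2 * p + 2) * (2 ^ Suc k - 1)"
      using b aux by metis
    then show "j \<in> J" using Suc.prems by blast
  qed
  \<comment> \<open>The shift by \<open>2 ^ Suc k * j\<close> is even: it keeps the parity, hence
    the rule, and moves the stencil by \<open>2 ^ k * j\<close>.\<close>
  have ker: "impulse p c (Suc k) (n - 2 ^ Suc k * j) =
      (\<Sum>t<2 * p + 2. c (nat l) t * impulse p c k (n div 2 - int p + int t - 2 ^ k * j))" for j
  proof -
    have "(n - 2 ^ Suc k * j) = n + 2 * (- (2 ^ k * j))" by simp
    then have "(n - 2 ^ Suc k * j) mod 2 = l" "(n - 2 ^ Suc k * j) div 2 = n div 2 - 2 ^ k * j"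
      unfolding l_def by presburger+
    moreover have "impulse p c (Suc k) m =
        (\<Sum>t<2 * p + 2. c (nat (m mod 2)) t * impulse p c k (m div 2 - int p + int t))" for m
      by (simp only: impulse_def funpow.simps o_apply refine_def real_scaleR_def)
    moreover have "n div 2 - 2 ^ k * j - int p + int t = n div 2 - int p + int t - 2 ^ k * j" for t
      by simp
    ultimately show ?thesis by (simp only:)
  qed
  have "(refine p c ^^ Suc k) g n =
      (\<Sum>t<2 * p + 2. c (nat l) t *\<^sub>R (refine p c ^^ k) g (n div 2 - int p + int t))"
    by (simp only: funpow.simps o_apply refine_def l_def)
  also have "\<dots> = (\<Sum>t<2 * p + 2. c (nat l) t *\<^sub>R
      (\<Sum>j\<in>J. impulse p c k (n div 2 - int p + int t - 2 ^ k * j) *\<^sub>R g j))"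
    by (intro sum.cong refl arg_cong2[of _ _ _ _ "(*\<^sub>R)"] Suc.IH sub) auto
  also have "\<dots> = (\<Sum>j\<in>J. impulse p c (Suc k) (n - 2 ^ Suc k * j) *\<^sub>R g j)"
    unfolding ker scaleR_sum_right scaleR_sum_left scaleR_scaleR by (rule sum.swap)
  finally show ?case .
qed

text \<open>The representation formula is applied to the unit impulse itself: only
  \<open>j = 0\<close> could contribute, and for such \<open>n\<close> it lies outside the index
  set.\<close>

lemma impulse_eq_0:
  assumes "int (2 * p + 2) * (2 ^ k - 1) < \<bar>n\<bar>"
  shows "impulse p c k n = 0"
proof -
  have inj: "inj (\<lambda>j::int. n - 2 ^ k * j)" by (auto simp: inj_def)
  let ?J = "{j. \<bar>n - 2 ^ k * j\<bar> \<le> int (2 * p + 2) * (2 ^ k - 1)}"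
  have "finite ((\<lambda>j. n - 2 ^ k * j) -` {- (int (2 * p + 2) * (2 ^ k - 1)) .. int (2 * p + 2) * (2 ^ k - 1)})"
    by (rule finite_vimageI[OF _ inj]) simp
  then have "finite ?J" by (rule finite_subset[rotated]) auto
  from refine_pow_eq_sum_impulse[OF this order_refl, of c "\<lambda>i. if i = 0 then 1 else 0 :: real"]
  have "impulse p c k n = (\<Sum>j\<in>?J. impulse p c k (n - 2 ^ k * j) * (if j = 0 then 1 else 0))"
    by (simp add: impulse_def)
  also have "\<dots> = 0" using assms by (intro sum.neutral) auto
  finally show ?thesis .
qed

lemma refine_const:
  assumes "\<And>l. l < 2 \<Longrightarrow> (\<Sum>t<2 * p + 2. c l t) = 1"
  shows "refine p c (\<lambda>i. v) = (\<lambda>n. v)"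
proof
  fix n :: int
  have "nat (n mod 2) < 2" by auto
  then show "refine p c (\<lambda>i. v) n = v"
    unfolding refine_def scaleR_sum_left[symmetric] by (simp only: assms scaleR_one)
qed

lemma refine_pow_const:
  assumes "\<And>l. l < 2 \<Longrightarrow> (\<Sum>t<2 * p + 2. c l t) = 1"
  shows "(refine p c ^^ k) (\<lambda>i. v) = (\<lambda>n. v)"
  by (induction k) (simp_all add: refine_const[OF assms])

subsection \<open>Norm equivalence and the perturbation estimate\<close>

text \<open>Bolzano-Weierstrass by induction on the dimension, which is a number here and not a
  type: the subsequence is refined once for each coordinate.\<close>

lemma convergent_subsequence_coordinatewise:
  fixes X :: "nat \<Rightarrow> nat \<Rightarrow> real"
  assumes "\<And>n j. j < m \<Longrightarrow> \<bar>X n j\<bar> \<le> 1"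
  shows "\<exists>r x. strict_mono (r :: nat \<Rightarrow> nat) \<and> (\<forall>j<m. (\<lambda>n. X (r n) j) \<longlonglongrightarrow> x j)"
  using assms
proof (induction m)
  case 0
  then show ?case by (auto intro: exI[of _ id] simp: strict_mono_id)
next
  case (Suc m)
  then obtain r x where r: "strict_mono (r :: nat \<Rightarrow> nat)"
      and x: "\<And>j. j < m \<Longrightarrow> (\<lambda>n. X (r n) j) \<longlonglongrightarrow> x j"
    by (metis less_Suc_eq)
  have "bounded (range (\<lambda>n. X (r n) m))"
    using Suc.prems[of m] by (auto simp: bounded_iff)
  then obtain y s where s: "strict_mono (s :: nat \<Rightarrow> nat)"
      and y: "((\<lambda>n. X (r n) m) \<circ> s) \<longlonglongrightarrow> y"
    using bounded_imp_convergent_subsequence by blast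
  have "(\<lambda>n. X ((r \<circ> s) n) j) \<longlonglongrightarrow> (x(m := y)) j" if "j < Suc m" for j
  proof (cases "j = m")
    case True
    then show ?thesis using y by (simp add: o_def)
  next
    case False
    with that have "j < m" by simp
    from LIMSEQ_subseq_LIMSEQ[OF x[OF this] s] False show ?thesis by (simp add: o_def)
  qed
  moreover have "strict_mono (r \<circ> s)" using r s by (rule strict_mono_o)
  ultimately show ?case by blast
qed

lemma norm_on_le_sum_coordinates:
  assumes "is_norm_on m N"
  shows "N (Matrix.vec m x) \<le> (\<Sum>j<m. \<bar>x j\<bar> * N (unit_vec m j))"
proof -
  \<comment> \<open>Induction over truncations: the vector is built up one coordinate at a time,
    each costing one triangle inequality.\<close>
  have "N (Matrix.vec m (\<lambda>i. if i < t then x i else 0)) \<le> (\<Sum>j<t. \<bar>x j\<bar> * N (unit_vec m j))"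
    if "t \<le> m" for t
    using that
  proof (induction t)
    case 0
    have "Matrix.vec m (\<lambda>i. 0 :: real) = 0\<^sub>v m" by auto
    moreover have "N (0\<^sub>v m) = 0" using assms zero_carrier_vec[of m] by (simp add: is_norm_on_def)
    ultimately show ?case by simp
  next
    case (Suc t)
    have "Matrix.vec m (\<lambda>i. if i < Suc t then x i else 0) =
        Matrix.vec m (\<lambda>i. if i < t then x i else 0) + x t \<cdot>\<^sub>v unit_vec m t"
      using Suc.prems by (intro eq_vecI) (auto simp: less_Suc_eq)
    moreover have "N (v + w) \<le> N v + N w" if "v \<in> carrier_vec m" "w \<in> carrier_vec m" for v w
      using assms that by (simp add: is_norm_on_def)
    moreover have "N (x t \<cdot>\<^sub>v unit_vec m t) = \<bar>x t\<bar> * N (unit_vec m t)"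
      using assms by (simp add: is_norm_on_def)
    ultimately have "N (Matrix.vec m (\<lambda>i. if i < Suc t then x i else 0)) \<le>
        N (Matrix.vec m (\<lambda>i. if i < t then x i else 0)) + \<bar>x t\<bar> * N (unit_vec m t)"
      by (metis smult_carrier_vec unit_vec_carrier vec_carrier)
    with Suc show ?case by simp
  qed
  from this[OF order_refl] show ?thesis
    by (smt (verit) dim_vec eq_vecI index_vec)
qed

text \<open>The half of norm equivalence that needs compactness: otherwise vectors of coordinate sum
  norm one with \<open>N\<close> tending to 0 would accumulate at a nonzero vector of norm 0. It
  makes the arbitrary norm on coefficient vectors in class B usable coordinate by
  coordinate.\<close>

lemma sum_coordinates_le_norm_on:
  assumes "is_norm_on m N"
  shows "\<exists>\<kappa>\<ge>0. \<forall>v\<in>carrier_vec m. (\<Sum>j<m. \<bar>vec_index v j\<bar>) \<le> \<kappa> * N v"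
proof (rule ccontr)
  assume neg: "\<not> ?thesis"
  have N0: "0 \<le> N v" "N v = 0 \<longleftrightarrow> v = 0\<^sub>v m" if "v \<in> carrier_vec m" for v
    using assms that by (simp_all add: is_norm_on_def)
  have Nsmult: "N (a \<cdot>\<^sub>v v) = \<bar>a\<bar> * N v" if "v \<in> carrier_vec m" for a v
    using assms that by (simp add: is_norm_on_def)
  have Nadd: "N (v + w) \<le> N v + N w" if "v \<in> carrier_vec m" "w \<in> carrier_vec m" for v w
    using assms that by (simp add: is_norm_on_def)
  have "\<exists>x. (\<Sum>j<m. \<bar>x j\<bar>) = 1 \<and> N (Matrix.vec m x) \<le> 1 / real (Suc n)" for n
  proof -
    obtain v where v: "v \<in> carrier_vec m"
        and lt: "real (Suc n) * N v < (\<Sum>j<m. \<bar>vec_index v j\<bar>)"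
      using neg by (metis not_le of_nat_0_le_iff)
    define s where "s = (\<Sum>j<m. \<bar>vec_index v j\<bar>)"
    have s: "0 < s"
      using lt N0(1)[OF v] unfolding s_def[symmetric]
      by (meson mult_nonneg_nonneg of_nat_0_le_iff le_less_trans)
    have "(\<Sum>j<m. \<bar>vec_index v j / s\<bar>) = 1"
      using s by (simp add: sum_divide_distrib[symmetric] s_def[symmetric])
    moreover have "Matrix.vec m (\<lambda>j. vec_index v j / s) = (1 / s) \<cdot>\<^sub>v v"
      using v by (intro eq_vecI) auto
    then have "N (Matrix.vec m (\<lambda>j. vec_index v j / s)) = N v / s"
      using s by (simp add: Nsmult[OF v])
    then have "N (Matrix.vec m (\<lambda>j. vec_index v j / s)) \<le> 1 / real (Suc n)"
      using lt s unfolding s_def[symmetric] by (simp only: divide_le_eq le_divide_eq) (simp add: mult.commute)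
    ultimately show ?thesis by (intro exI[of _ "\<lambda>j. vec_index v j / s"] conjI)
  qed
  then obtain X where X1: "\<And>n. (\<Sum>j<m. \<bar>X n j\<bar>) = 1"
      and X2: "\<And>n. N (Matrix.vec m (X n)) \<le> 1 / real (Suc n)"
    by metis
  have "\<bar>X n j\<bar> \<le> 1" if "j < m" for n j
    using member_le_sum[of j "{..<m}" "\<lambda>j. \<bar>X n j\<bar>"] that by (simp add: X1)
  then obtain r x where r: "strict_mono (r :: nat \<Rightarrow> nat)"
      and x: "\<And>j. j < m \<Longrightarrow> (\<lambda>n. X (r n) j) \<longlonglongrightarrow> x j"
    using convergent_subsequence_coordinatewise[of m X] by blast
  have "(\<lambda>n. \<Sum>j<m. \<bar>X (r n) j\<bar>) \<longlonglongrightarrow> (\<Sum>j<m. \<bar>x j\<bar>)"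
    by (intro tendsto_sum tendsto_rabs x) simp
  then have sum1: "(\<Sum>j<m. \<bar>x j\<bar>) = 1"
    unfolding X1 by (simp add: LIMSEQ_const_iff)
  \<comment> \<open>Continuity of \<open>N\<close> in disguise: the distance from the limit
    \<open>x\<close> to the sequence is controlled by the easy half of norm equivalence.\<close>
  have bound: "N (Matrix.vec m x) \<le>
      (\<Sum>j<m. \<bar>x j - X (r n) j\<bar> * N (unit_vec m j)) + 1 / real (Suc (r n))" for n
  proof -
    have "Matrix.vec m x = Matrix.vec m (\<lambda>j. x j - X (r n) j) + Matrix.vec m (X (r n))"
      by auto
    then have "N (Matrix.vec m x) \<le>
        N (Matrix.vec m (\<lambda>j. x j - X (r n) j)) + N (Matrix.vec m (X (r n)))"
      by (metis Nadd vec_carrier)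
    then show ?thesis
      using norm_on_le_sum_coordinates[OF assms, of "\<lambda>j. x j - X (r n) j"] X2[of "r n"] by linarith
  qed
  have "(\<lambda>n. 1 / real (Suc (r n))) \<longlonglongrightarrow> 0"
    using LIMSEQ_subseq_LIMSEQ[OF lim_1_over_n[THEN LIMSEQ_Suc] r] by (simp add: o_def)
  moreover have "(\<lambda>n. \<Sum>j<m. \<bar>x j - X (r n) j\<bar> * N (unit_vec m j)) \<longlonglongrightarrow>
      (\<Sum>j<m. \<bar>x j - x j\<bar> * N (unit_vec m j))"
    by (intro tendsto_intros x) simp
  ultimately have "(\<lambda>n. (\<Sum>j<m. \<bar>x j - X (r n) j\<bar> * N (unit_vec m j)) + 1 / real (Suc (r n)))
      \<longlonglongrightarrow> (\<Sum>j<m. \<bar>x j - x j\<bar> * N (unit_vec m j)) + 0"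
    by (rule tendsto_add[rotated])
  then have "N (Matrix.vec m x) \<le> (\<Sum>j<m. \<bar>x j - x j\<bar> * N (unit_vec m j)) + 0"
    by (rule LIMSEQ_le_const) (use bound in blast)
  then have "Matrix.vec m x = 0\<^sub>v m"
    using N0[of "Matrix.vec m x"] by simp
  then have "x j = 0" if "j < m" for j
    by (metis index_vec index_zero_vec(1) that)
  then show False using sum1 by simp
qed

section \<open>Class B schemes as perturbations of the linear scheme\<close>

lemma pairing_eq_sum:
  "v \<in> carrier_vec m \<Longrightarrow> pairing v w = (\<Sum>t<m. vec_index v t *\<^sub>R vec_index w t)"
  unfolding pairing_def by (simp add: carrier_vecD)

lemma pairing_window:
  assumes "v \<in> carrier_vec (2 * p + 2)"
  shows "pairing v (window p f i) = (\<Sum>t<2 * p + 2. vec_index v t *\<^sub>R f (i - int p + int t))"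
  unfolding pairing_eq_sum[OF assms] window_def by (intro sum.cong) auto

lemma pairing_ones:
  assumes "v \<in> carrier_vec m"
  shows "pairing v (Matrix.vec m (\<lambda>j. 1 :: real)) = (\<Sum>t<m. vec_index v t)"
  unfolding pairing_eq_sum[OF assms] by (intro sum.cong) auto

lemma linear_scheme_eq_refine:
  assumes "\<And>l. l < 2 \<Longrightarrow> a l \<in> carrier_vec (2 * p + 2)"
  shows "linear_scheme p a k f = refine p (\<lambda>l. vec_index (a l)) f"
proof
  fix n :: int
  have "nat (n mod 2) < 2" by auto
  from pairing_window[OF assms[OF this]]
  show "linear_scheme p a k f n = refine p (\<lambda>l. vec_index (a l)) f n"
    unfolding linear_scheme_def refine_def by blast
qed

text \<open>
  Both coefficient vectors sum to one, so their difference only sees differences of control points.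
\<close>

lemma class_B_perturbation:
  fixes S :: "nat \<Rightarrow> (int \<Rightarrow> real^'n) \<Rightarrow> int \<Rightarrow> real^'n"
  assumes B: "class_B p \<Psi> q D \<pi> \<Lambda> \<rho> C S"
    and ones: "\<forall>x\<in>D. \<forall>l<2. pairing (\<Lambda> l x) (Matrix.vec (2 * p + 2) (\<lambda>j. 1 :: real)) = 1"
  shows "\<exists>\<kappa>\<ge>0. \<forall>k. \<forall>f\<in>linf. \<forall>n.
    norm (S k f n - refine p (\<lambda>l. vec_index (\<Lambda> l (0\<^sub>v q))) f n) \<le> \<kappa> / 2 ^ k * jump f"
proof -
  let ?m = "2 * p + 2"
  have unif: "uniform_scheme p \<Psi> S" and zero: "0\<^sub>v q \<in> D"
    and piD: "\<And>k v. v \<in> carrier_vec ?m \<Longrightarrow> \<pi> k v \<in> D"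
    and Lam: "\<And>l x. l < 2 \<Longrightarrow> x \<in> D \<Longrightarrow> \<Lambda> l x \<in> carrier_vec ?m"
    and pos: "0 < \<rho>" "0 < C"
    using B unfolding class_B_def by blast+
  from B obtain Nq Nm where Nm: "is_norm_on ?m Nm"
    and "\<forall>l<2. \<forall>k. \<forall>v\<in>carrier_vec ?m. \<Psi> k l v = pairing (\<Lambda> l (\<pi> k v)) v"
    and "\<forall>k. \<forall>v\<in>carrier_vec ?m. Nq (\<pi> k v) \<le> \<rho> / 2 ^ k"
    and "\<forall>l<2. \<forall>x\<in>D. Nm (\<Lambda> l x - \<Lambda> l (0\<^sub>v q)) \<le> C * Nq x"
    unfolding class_B_def by (elim conjE exE) (rule that)
  then have Psi: "\<And>l k v. l < 2 \<Longrightarrow> v \<in> carrier_vec ?m \<Longrightarrow> \<Psi> k l v = pairing (\<Lambda> l (\<pi> k v)) v"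
    and small: "\<And>k v. v \<in> carrier_vec ?m \<Longrightarrow> Nq (\<pi> k v) \<le> \<rho> / 2 ^ k"
    and Lip: "\<And>l x. l < 2 \<Longrightarrow> x \<in> D \<Longrightarrow> Nm (\<Lambda> l x - \<Lambda> l (0\<^sub>v q)) \<le> C * Nq x"
    by simp_all
  from sum_coordinates_le_norm_on[OF Nm] obtain \<kappa> where "0 \<le> \<kappa>"
    and \<kappa>: "\<And>v. v \<in> carrier_vec ?m \<Longrightarrow> (\<Sum>j<?m. \<bar>vec_index v j\<bar>) \<le> \<kappa> * Nm v"
    by blast
  \<comment> \<open>The factors are the norm equivalence constant (called \<kappa> here), the
    Lipschitz constant of \<Lambda>, the bound on \<pi>, and the stencil length, which bounds the
    distance of an entry from the first one.\<close>
  have "norm (S k f n - refine p (\<lambda>l. vec_index (\<Lambda> l (0\<^sub>v q))) f n)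
      \<le> (\<kappa> * C * \<rho> * real ?m) / 2 ^ k * jump f" if f: "f \<in> linf" for k f n
  proof -
    define l where "l = nat (n mod 2)"
    define i where "i = n div 2"
    define w where "w = window p f i"
    have l: "l < 2" unfolding l_def by auto
    have n: "n = 2 * i + int l" unfolding l_def i_def by simp
    have bf: "bounded (range f)" using f by (simp add: linf_def)
    have w: "w \<in> carrier_vec ?m" unfolding w_def window_def by simp
    let ?v = "\<Lambda> l (\<pi> k w)" and ?u = "\<Lambda> l (0\<^sub>v q)"
    let ?d = "\<lambda>t. vec_index ?v t - vec_index ?u t"
    let ?f = "\<lambda>t. f (i - int p + int t)"
    have v: "?v \<in> carrier_vec ?m" "?u \<in> carrier_vec ?m"
      using Lam[OF l] piD[OF w] zero by auto
    have "(\<Sum>t<?m. ?d t) = 0"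
      using ones l piD[OF w] zero pairing_ones[OF v(1)] pairing_ones[OF v(2)]
      by (simp only: sum_subtractf)
    then have d0: "(\<Sum>t<?m. ?d t *\<^sub>R f (i - int p)) = 0"
      by (simp only: scaleR_sum_left[symmetric] scaleR_zero_left)
    have "S k f (2 * i + int l) = pairing ?v w"
      using unif f l Psi[OF l w, of k] unfolding uniform_scheme_def w_def by simp
    moreover have "refine p (\<lambda>l. vec_index (\<Lambda> l (0\<^sub>v q))) f n = (\<Sum>t<?m. vec_index ?u t *\<^sub>R ?f t)"
      by (simp only: refine_def l_def i_def)
    ultimately have "S k f n - refine p (\<lambda>l. vec_index (\<Lambda> l (0\<^sub>v q))) f n =
        pairing ?v w - (\<Sum>t<?m. vec_index ?u t *\<^sub>R ?f t)"
      by (simp only: n)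
    also have "\<dots> = (\<Sum>t<?m. ?d t *\<^sub>R ?f t)"
      unfolding w_def pairing_window[OF v(1)[unfolded w_def]]
      by (simp only: scaleR_diff_left sum_subtractf)
    also have "\<dots> = (\<Sum>t<?m. ?d t *\<^sub>R (?f t - f (i - int p)))"
      by (simp only: scaleR_diff_right sum_subtractf d0 diff_zero)
    also have "norm \<dots> \<le> (\<Sum>t<?m. \<bar>?d t\<bar> * (real ?m * jump f))"
    proof (intro order_trans[OF norm_sum] sum_mono)
      fix t assume "t \<in> {..<?m}"
      then have t: "real t \<le> real ?m" by simp
      have "norm (?f t - f (i - int p)) \<le> \<bar>real_of_int (i - int p + int t - (i - int p))\<bar> * jump f"
        by (rule norm_diff_le_jump[OF bf])
      also have "\<dots> = real t * jump f" by simp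
      also have "\<dots> \<le> real ?m * jump f"
        by (rule mult_right_mono[OF t jump_nonneg[OF bf]])
      finally show "norm (?d t *\<^sub>R (?f t - f (i - int p))) \<le> \<bar>?d t\<bar> * (real ?m * jump f)"
        by (simp only: norm_scaleR) (rule mult_left_mono, simp_all)
    qed
    also have "\<dots> = (\<Sum>t<?m. \<bar>vec_index (?v - ?u) t\<bar>) * (real ?m * jump f)"
      unfolding sum_distrib_right using v by (intro sum.cong) auto
    also have "\<dots> \<le> (\<kappa> * (C * (\<rho> / 2 ^ k))) * (real ?m * jump f)"
    proof (rule mult_right_mono)
      have "(\<Sum>t<?m. \<bar>vec_index (?v - ?u) t\<bar>) \<le> \<kappa> * Nm (?v - ?u)"
        using v by (intro \<kappa>) auto
      also have "\<dots> \<le> \<kappa> * (C * Nq (\<pi> k w))"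
        by (intro mult_left_mono Lip l piD w \<open>0 \<le> \<kappa>\<close>)
      also have "\<dots> \<le> \<kappa> * (C * (\<rho> / 2 ^ k))"
        using pos by (intro mult_left_mono small w \<open>0 \<le> \<kappa>\<close>) auto
      finally show "(\<Sum>t<?m. \<bar>vec_index (?v - ?u) t\<bar>) \<le> \<kappa> * (C * (\<rho> / 2 ^ k))" .
    qed (use jump_nonneg[OF bf] in auto)
    finally show ?thesis by (simp add: mult_ac)
  qed
  moreover have "0 \<le> \<kappa> * C * \<rho> * real ?m" using pos \<open>0 \<le> \<kappa>\<close> by simp
  ultimately show ?thesis by blast
qed

subsection \<open>Superpositions of integer translates\<close>

text \<open>
  The radius is the support radius \<open>2 * p + 2\<close> of \<open>\<phi>\<close>, plus one for rounding \<open>x\<close> and one so that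
  a single index set serves all points at distance at most one from \<open>x\<close>.
\<close>

definition near :: "nat \<Rightarrow> real \<Rightarrow> int set" where
  "near p x = {\<lfloor>x\<rfloor> - int (2 * p + 4) .. \<lfloor>x\<rfloor> + int (2 * p + 4)}"

lemma finite_near [simp]: "finite (near p x)"
  by (simp add: near_def)

lemma card_near: "card (near p x) = 4 * p + 9"
  by (simp add: near_def)

lemma mem_near:
  assumes "\<bar>y - x\<bar> \<le> 1" "\<bar>y - real_of_int j\<bar> \<le> real (2 * p + 2)"
  shows "j \<in> near p x"
proof -
  have "real_of_int j \<le> real_of_int (\<lfloor>x\<rfloor> + int (2 * p + 4))"
    "real_of_int (\<lfloor>x\<rfloor> - int (2 * p + 4)) \<le> real_of_int j"
    using assms floor_correct[of x] by simp_all linarith+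
  then show ?thesis unfolding near_def of_int_le_iff by simp
qed

text \<open>Stands for the sum over all integers \<open>j\<close>; for \<phi> vanishing outside
  radius \<open>2 * p + 2\<close>, cutting it down to \<open>near p x\<close> loses nothing and
  keeps it finite.\<close>

definition synth :: "nat \<Rightarrow> (real \<Rightarrow> real) \<Rightarrow> (int \<Rightarrow> 'b::real_vector) \<Rightarrow> real \<Rightarrow> 'b" where
  "synth p \<phi> g x = (\<Sum>j\<in>near p x. \<phi> (x - real_of_int j) *\<^sub>R g j)"

text \<open>The index set in \<open>synth\<close> changes with its argument. Freezing it at
  \<open>x\<close> makes \<open>synth\<close> a fixed finite sum around \<open>x\<close>, which can
  be differentiated termwise.\<close>

lemma synth_eq_sum_near:
  assumes supp: "\<And>x. real (2 * p + 2) < \<bar>x\<bar> \<Longrightarrow> \<phi> x = 0" and "\<bar>y - x\<bar> \<le> 1"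
  shows "synth p \<phi> g y = (\<Sum>j\<in>near p x. \<phi> (y - real_of_int j) *\<^sub>R g j)"
proof -
  have out: "\<phi> (y - real_of_int j) = 0" if "j \<notin> near p x \<or> j \<notin> near p y" for j
  proof (rule supp, rule ccontr)
    assume "\<not> real (2 * p + 2) < \<bar>y - real_of_int j\<bar>"
    then have "\<bar>y - real_of_int j\<bar> \<le> real (2 * p + 2)" by simp
    with mem_near[OF assms(2) this] mem_near[of y y j p] that show False by simp
  qed
  have "synth p \<phi> g y = (\<Sum>j\<in>near p x \<union> near p y. \<phi> (y - real_of_int j) *\<^sub>R g j)"
    unfolding synth_def by (rule sum.mono_neutral_left) (auto simp: out)
  also have "\<dots> = (\<Sum>j\<in>near p x. \<phi> (y - real_of_int j) *\<^sub>R g j)"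
    by (rule sum.mono_neutral_right) (auto simp: out)
  finally show ?thesis .
qed

lemma continuous_on_synth:
  fixes g :: "int \<Rightarrow> 'b::real_normed_vector"
  assumes supp: "\<And>x. real (2 * p + 2) < \<bar>x\<bar> \<Longrightarrow> \<phi> x = 0" and cont: "continuous_on UNIV \<phi>"
  shows "continuous_on UNIV (synth p \<phi> g)"
  unfolding continuous_on_eq_continuous_at[OF open_UNIV]
proof
  fix x :: real
  have "continuous_on (ball x 1) (synth p \<phi> g) \<longleftrightarrow>
      continuous_on (ball x 1) (\<lambda>y. \<Sum>j\<in>near p x. \<phi> (y - real_of_int j) *\<^sub>R g j)"
    using synth_eq_sum_near[OF supp, where x = x and g = g]
    by (intro continuous_on_cong refl) (auto simp: dist_real_def abs_minus_commute)
  also have "\<dots>"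
    by (intro continuous_intros continuous_on_compose2[OF cont]) auto
  finally show "isCont (synth p \<phi> g) x"
    by (simp add: continuous_on_eq_continuous_at)
qed

lemma has_vector_derivative_synth:
  fixes g :: "int \<Rightarrow> 'b::real_normed_vector"
  assumes supp: "\<And>x. real (2 * p + 2) < \<bar>x\<bar> \<Longrightarrow> \<phi> x = 0"
    and der: "\<And>x. (\<phi> has_real_derivative \<phi>' x) (at x)"
  shows "(synth p \<phi> g has_vector_derivative synth p \<phi>' g x) (at x)"
proof (rule has_vector_derivative_transform_within_open)
  have "((\<lambda>y. \<phi> (y - real_of_int j) *\<^sub>R g j) has_vector_derivative
      \<phi>' (x - real_of_int j) *\<^sub>R g j) (at x)" for j
    by (auto intro!: derivative_eq_intros DERIV_chain'[OF _ der])
  then show "((\<lambda>y. \<Sum>j\<in>near p x. \<phi> (y - real_of_int j) *\<^sub>R g j) has_vector_derivative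
      synth p \<phi>' g x) (at x)"
    unfolding synth_def by (rule has_vector_derivative_sum)
  show "open (ball x 1)" "x \<in> ball x 1" by auto
  show "(\<Sum>j\<in>near p x. \<phi> (y - real_of_int j) *\<^sub>R g j) = synth p \<phi> g y" if "y \<in> ball x 1" for y
    using synth_eq_sum_near[OF supp, where x = x and g = g and y = y] that
    by (auto simp: dist_real_def abs_minus_commute)
qed

lemma norm_synth_le:
  assumes "\<And>x. \<bar>\<phi> x\<bar> \<le> K" "\<And>i. norm (g i) \<le> B"
  shows "norm (synth p \<phi> g x) \<le> real (4 * p + 9) * (K * B)"
proof -
  have "0 \<le> K" using assms(1)[of 0] by linarith
  then have "norm (synth p \<phi> g x) \<le> (\<Sum>j\<in>near p x. K * B)"
    unfolding synth_def using assms
    by (intro order_trans[OF norm_sum] sum_mono) (auto intro!: mult_mono)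
  then show ?thesis by (simp only: sum_constant card_near)
qed

lemma synth_diff: "synth p \<phi> (\<lambda>i. f i - g i) x = synth p \<phi> f x - synth p \<phi> g x"
  by (simp add: synth_def scaleR_diff_right sum_subtractf)

lemma bounded_vanishing_outside:
  fixes \<phi> :: "real \<Rightarrow> real"
  assumes cont: "continuous_on UNIV \<phi>" and supp: "\<And>x. R < \<bar>x\<bar> \<Longrightarrow> \<phi> x = 0"
  shows "\<exists>K>0. \<forall>x. \<bar>\<phi> x\<bar> \<le> K"
proof -
  have "bounded (\<phi> ` {-R..R})"
    by (intro compact_imp_bounded compact_continuous_image continuous_on_subset[OF cont]) auto
  then obtain K where K: "K > 0" "\<And>x. x \<in> {-R..R} \<Longrightarrow> \<bar>\<phi> x\<bar> \<le> K"
    unfolding bounded_pos by auto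
  have "\<bar>\<phi> x\<bar> \<le> K" for x
  proof (cases "R < \<bar>x\<bar>")
    case False
    then have "x \<in> {-R..R}" by auto
    then show ?thesis by (rule K(2))
  qed (use K(1) supp in simp)
  with K(1) show ?thesis by blast
qed

lemma abs_dyadic_diff: "\<bar>y / 2 ^ k - x\<bar> = \<bar>y - 2 ^ k * x\<bar> / 2 ^ k" for x y :: real
proof -
  have "y / 2 ^ k - x = (y - 2 ^ k * x) / 2 ^ k" by (simp add: field_simps)
  then show ?thesis by (simp only: abs_divide) simp
qed

lemma floor_dyadic_diff: "\<bar>real_of_int \<lfloor>2 ^ k * x\<rfloor> / 2 ^ k - x\<bar> \<le> 1 / 2 ^ k"
proof -
  have "\<bar>real_of_int \<lfloor>2 ^ k * x\<rfloor> / 2 ^ k - x\<bar> = \<bar>real_of_int \<lfloor>2 ^ k * x\<rfloor> - 2 ^ k * x\<bar> / 2 ^ k"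
    by (rule abs_dyadic_diff)
  also have "\<dots> \<le> 1 / 2 ^ k"
    by (rule divide_right_mono) (linarith, simp)
  finally show ?thesis .
qed

subsection \<open>Perturbations of a linear scheme with smooth limits\<close>

text \<open>Here \<phi> is the scalar basic limit function. The limit of \<open>impulse\<close> is
  uniform over all integers; the refinement equation and the partition of unity are derived from it
  and \<open>sum_one\<close>.\<close>

locale C1_refinable =
  fixes p :: nat and c :: "nat \<Rightarrow> nat \<Rightarrow> real" and \<phi> \<phi>' :: "real \<Rightarrow> real"
  assumes sum_one: "l < 2 \<Longrightarrow> (\<Sum>t<2 * p + 2. c l t) = 1"
    and supp: "real (2 * p + 2) < \<bar>x\<bar> \<Longrightarrow> \<phi> x = 0"
    and deriv: "(\<phi> has_real_derivative \<phi>' x) (at x)"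
    and cont_deriv: "continuous_on UNIV \<phi>'"
    and impulse_lim: "e > 0 \<Longrightarrow>
      \<forall>\<^sub>F k in sequentially. \<forall>n. \<bar>impulse p c k n - \<phi> (real_of_int n / 2 ^ k)\<bar> \<le> e"
begin

lemma cont: "continuous_on UNIV \<phi>"
  using deriv by (meson DERIV_isCont continuous_at_imp_continuous_on)

lemma supp_deriv:
  assumes "real (2 * p + 2) < \<bar>x\<bar>"
  shows "\<phi>' x = 0"
proof -
  have "open {x :: real. real (2 * p + 2) < \<bar>x\<bar>}"
    by (intro open_Collect_less continuous_intros)
  from has_field_derivative_transform_within_open[OF deriv[of x] this] assms supp
  have "((\<lambda>x. 0) has_real_derivative \<phi>' x) (at x)" by auto
  then show ?thesis by (rule DERIV_unique) simp
qed

lemma ex_bound: "\<exists>K>0. \<forall>x. \<bar>\<phi> x\<bar> \<le> K"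
  by (rule bounded_vanishing_outside[OF cont supp])

lemma ex_bound_deriv: "\<exists>K>0. \<forall>x. \<bar>\<phi>' x\<bar> \<le> K"
  by (rule bounded_vanishing_outside[OF cont_deriv supp_deriv])

text \<open>The slack of one around \<open>x\<close> lets the neighbours \<open>n\<close> and
  \<open>n + 1\<close> be expanded over the same index set.\<close>

lemma refine_pow_eq_sum_near:
  assumes "\<bar>real_of_int n / 2 ^ k - x\<bar> \<le> 1"
  shows "(refine p c ^^ k) g n = (\<Sum>j\<in>near p x. impulse p c k (n - 2 ^ k * j) *\<^sub>R g j)"
proof (rule refine_pow_eq_sum_impulse)
  show "{j. \<bar>n - 2 ^ k * j\<bar> \<le> int (2 * p + 2) * (2 ^ k - 1)} \<subseteq> near p x"
  proof
    fix j assume "j \<in> {j. \<bar>n - 2 ^ k * j\<bar> \<le> int (2 * p + 2) * (2 ^ k - 1)}"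
    then have "\<bar>n - 2 ^ k * j\<bar> \<le> int (2 * p + 2) * (2 ^ k - 1)" by simp
    also have "\<dots> \<le> int (2 * p + 2) * 2 ^ k" by (simp add: algebra_simps)
    finally have "real_of_int \<bar>n - 2 ^ k * j\<bar> \<le> real_of_int (int (2 * p + 2) * 2 ^ k)"
      by (simp only: of_int_le_iff)
    then have "\<bar>real_of_int n - 2 ^ k * real_of_int j\<bar> \<le> real (2 * p + 2) * 2 ^ k" by simp
    moreover have "\<bar>real_of_int n / 2 ^ k - real_of_int j\<bar> =
        \<bar>real_of_int n - 2 ^ k * real_of_int j\<bar> / 2 ^ k"
      by (rule abs_dyadic_diff)
    ultimately have "\<bar>real_of_int n / 2 ^ k - real_of_int j\<bar> \<le> real (2 * p + 2)"
      by (simp only: pos_divide_le_eq[OF zero_less_power] zero_less_numeral)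
    with mem_near[OF assms] show "j \<in> near p x" by blast
  qed
qed simp

section \<open>Limits of the linear scheme and the refinement equation\<close>

lemma impulse_tendsto: "(\<lambda>k. impulse p c k (\<lfloor>2 ^ k * x\<rfloor> - 2 ^ k * j)) \<longlonglongrightarrow> \<phi> (x - real_of_int j)"
proof -
  let ?y = "\<lambda>k. real_of_int (\<lfloor>2 ^ k * x\<rfloor> - 2 ^ k * j) / 2 ^ k"
  have "(\<lambda>k. 1 / 2 ^ k :: real) \<longlonglongrightarrow> 0" by real_asymp
  then have "(\<lambda>k. real_of_int \<lfloor>2 ^ k * x\<rfloor> / 2 ^ k - x) \<longlonglongrightarrow> 0"
    by (rule Lim_null_comparison[rotated]) (simp add: floor_dyadic_diff)
  then have "(\<lambda>k. (real_of_int \<lfloor>2 ^ k * x\<rfloor> / 2 ^ k - x) + (x - real_of_int j)) \<longlonglongrightarrow>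
      0 + (x - real_of_int j)"
    by (intro tendsto_intros)
  moreover have "?y k = (real_of_int \<lfloor>2 ^ k * x\<rfloor> / 2 ^ k - x) + (x - real_of_int j)" for k
    by (simp add: field_simps)
  ultimately have "?y \<longlonglongrightarrow> x - real_of_int j" by simp
  then have 1: "(\<lambda>k. \<phi> (?y k)) \<longlonglongrightarrow> \<phi> (x - real_of_int j)"
    by (rule isCont_tendsto_compose[rotated]) (use cont in \<open>simp add: continuous_on_eq_continuous_at\<close>)
  \<comment> \<open>Uniformity in \<open>n\<close> allows the sampling position to move with
    \<open>k\<close>.\<close>
  have 2: "(\<lambda>k. impulse p c k (\<lfloor>2 ^ k * x\<rfloor> - 2 ^ k * j) - \<phi> (?y k)) \<longlonglongrightarrow> 0"
  proof (rule tendstoI)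
    fix e :: real assume "0 < e"
    then have "0 < e / 2" by simp
    from impulse_lim[OF this] show "\<forall>\<^sub>F k in sequentially.
        dist (impulse p c k (\<lfloor>2 ^ k * x\<rfloor> - 2 ^ k * j) - \<phi> (?y k)) 0 < e"
    proof eventually_elim
      case (elim k)
      with \<open>0 < e\<close> show ?case
        by (metis dist_norm diff_zero real_norm_def field_sum_of_halves less_add_same_cancel1
            half_gt_zero order_le_less_trans)
    qed
  qed
  from tendsto_add[OF 2 1] show ?thesis by simp
qed

lemma refine_pow_tendsto:
  fixes g :: "int \<Rightarrow> 'b::real_normed_vector"
  shows "(\<lambda>k. (refine p c ^^ k) g \<lfloor>2 ^ k * x\<rfloor>) \<longlonglongrightarrow> synth p \<phi> g x"
proof -
  have "\<bar>real_of_int \<lfloor>2 ^ k * x\<rfloor> / 2 ^ k - x\<bar> \<le> 1" for k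
    by (rule order_trans[OF floor_dyadic_diff]) simp
  then have "(refine p c ^^ k) g \<lfloor>2 ^ k * x\<rfloor> =
      (\<Sum>j\<in>near p x. impulse p c k (\<lfloor>2 ^ k * x\<rfloor> - 2 ^ k * j) *\<^sub>R g j)" for k
    by (rule refine_pow_eq_sum_near)
  then show ?thesis
    unfolding synth_def by (simp only:) (intro tendsto_intros impulse_tendsto)
qed

text \<open>The refinement equation. Both sides are limits of one sequence: \<open>k\<close> rounds
  after a first round, sampled near \<open>2 * x\<close>, are \<open>Suc k\<close> rounds sampled
  near \<open>x\<close>.\<close>

lemma synth_refine:
  fixes g :: "int \<Rightarrow> 'b::real_normed_vector"
  shows "synth p \<phi> (refine p c g) (2 * x) = synth p \<phi> g x"
proof (rule LIMSEQ_unique)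
  show "(\<lambda>k. (refine p c ^^ k) (refine p c g) \<lfloor>2 ^ k * (2 * x)\<rfloor>) \<longlonglongrightarrow>
      synth p \<phi> (refine p c g) (2 * x)"
    by (rule refine_pow_tendsto)
  have "(refine p c ^^ k) (refine p c g) \<lfloor>2 ^ k * (2 * x)\<rfloor> =
      (refine p c ^^ Suc k) g \<lfloor>2 ^ Suc k * x\<rfloor>" for k
    by (simp add: funpow_swap1 mult_ac)
  then show "(\<lambda>k. (refine p c ^^ k) (refine p c g) \<lfloor>2 ^ k * (2 * x)\<rfloor>) \<longlonglongrightarrow> synth p \<phi> g x"
    using LIMSEQ_Suc[OF refine_pow_tendsto[of g x]] by simp
qed

text \<open>Partition of unity for the translates of \<phi>, inherited from the rounds, which fix
  constants.\<close>

lemma synth_const: "synth p \<phi> (\<lambda>i. v :: 'b::real_normed_vector) x = v"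
proof (rule LIMSEQ_unique)
  show "(\<lambda>k. (refine p c ^^ k) (\<lambda>i. v) \<lfloor>2 ^ k * x\<rfloor>) \<longlonglongrightarrow> synth p \<phi> (\<lambda>i. v) x"
    by (rule refine_pow_tendsto)
  show "(\<lambda>k. (refine p c ^^ k) (\<lambda>i. v) \<lfloor>2 ^ k * x\<rfloor>) \<longlonglongrightarrow> v"
    by (simp add: refine_pow_const[OF sum_one])
qed

section \<open>Estimates in terms of jumps\<close>

lemma norm_diff_near_le:
  assumes "bounded (range g)" "j \<in> near p x"
  shows "norm (g j - g \<lfloor>x\<rfloor>) \<le> real (2 * p + 4) * jump g"
proof -
  have "\<bar>j - \<lfloor>x\<rfloor>\<bar> \<le> int (2 * p + 4)" using assms(2) unfolding near_def by auto
  then have "\<bar>real_of_int (j - \<lfloor>x\<rfloor>)\<bar> \<le> real (2 * p + 4)" by linarith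
  from order_trans[OF norm_diff_le_jump[OF assms(1)] mult_right_mono[OF this jump_nonneg[OF assms(1)]]]
  show ?thesis .
qed

text \<open>Constants are reproduced, so \<open>g n\<close> may be subtracted from all control points.\<close>

lemma ex_synth_error:
  "\<exists>B>0. \<forall>(g :: int \<Rightarrow> 'b::real_normed_vector) n. bounded (range g) \<longrightarrow>
     norm (g n - synth p \<phi> g (real_of_int n)) \<le> B * jump g"
proof -
  obtain K where K: "K > 0" "\<And>x. \<bar>\<phi> x\<bar> \<le> K" using ex_bound by blast
  have "norm (g n - synth p \<phi> g (real_of_int n)) \<le>
      (real (4 * p + 9) * (K * real (2 * p + 4))) * jump g"
    if g: "bounded (range g)" for g :: "int \<Rightarrow> 'b" and n
  proof -
    let ?x = "real_of_int n"
    have "synth p \<phi> g ?x - g n = synth p \<phi> (\<lambda>i. g i - g n) ?x"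
      by (simp add: synth_diff synth_const)
    also have "norm \<dots> \<le> (\<Sum>j\<in>near p ?x. K * (real (2 * p + 4) * jump g))"
      unfolding synth_def
    proof (intro order_trans[OF norm_sum] sum_mono)
      fix j assume "j \<in> near p ?x"
      from norm_diff_near_le[OF g this]
      show "norm (\<phi> (?x - real_of_int j) *\<^sub>R (g j - g n)) \<le> K * (real (2 * p + 4) * jump g)"
        unfolding norm_scaleR using K by (intro mult_mono) auto
    qed
    also have "\<dots> = real (4 * p + 9) * (K * real (2 * p + 4)) * jump g"
      by (simp only: sum_constant card_near mult.assoc)
    finally show ?thesis by (simp only: norm_minus_commute)
  qed
  moreover have "0 < real (4 * p + 9) * (K * real (2 * p + 4))" using K by simp
  ultimately show ?thesis by blast
qed

text \<open>\<phi> is Lipschitz because its derivative is bounded, so samples at spacing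
  \<open>1 / 2 ^ k\<close> are close; replacing \<phi> by \<open>impulse\<close> costs two further
  thirds of \<open>e\<close>.\<close>

lemma eventually_impulse_step_small:
  assumes "e > 0"
  shows "\<forall>\<^sub>F k in sequentially. \<forall>n. \<bar>impulse p c k (n + 1) - impulse p c k n\<bar> \<le> e"
proof -
  obtain K where K: "K > 0" "\<And>x. \<bar>\<phi>' x\<bar> \<le> K" using ex_bound_deriv by blast
  have Lip: "\<bar>\<phi> x - \<phi> y\<bar> \<le> K * \<bar>x - y\<bar>" for x y
    using field_differentiable_bound[of UNIV \<phi> \<phi>' K x y] deriv K by simp
  have "(\<lambda>k. K * (1 / 2 ^ k)) \<longlonglongrightarrow> 0" by real_asymp
  then have "\<forall>\<^sub>F k in sequentially. K * (1 / 2 ^ k) < e / 3"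
    using assms by (intro order_tendstoD) auto
  moreover have "\<forall>\<^sub>F k in sequentially. \<forall>n. \<bar>impulse p c k n - \<phi> (real_of_int n / 2 ^ k)\<bar> \<le> e / 3"
    using assms by (intro impulse_lim) simp
  ultimately show ?thesis
  proof eventually_elim
    case (elim k)
    show ?case
    proof
      fix n
      have "real_of_int (n + 1) / 2 ^ k - real_of_int n / 2 ^ k = 1 / 2 ^ k"
        by (simp add: add_divide_distrib)
      then have "\<bar>\<phi> (real_of_int (n + 1) / 2 ^ k) - \<phi> (real_of_int n / 2 ^ k)\<bar> \<le> K * (1 / 2 ^ k)"
        using Lip[of "real_of_int (n + 1) / 2 ^ k" "real_of_int n / 2 ^ k"] by simp
      with elim(1) elim(2)[rule_format, of n] elim(2)[rule_format, of "n + 1"]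
      show "\<bar>impulse p c k (n + 1) - impulse p c k n\<bar> \<le> e" by linarith
    qed
  qed
qed

text \<open>A difference of neighbours after \<open>L\<close> rounds combines control points with
  increments of \<open>impulse\<close> as coefficients. These sum to zero, so only differences of
  control points enter, and they are uniformly small for large \<open>L\<close>.\<close>

lemma ex_contraction:
  "\<exists>L. \<forall>g :: int \<Rightarrow> 'b::real_normed_vector. bounded (range g) \<longrightarrow>
     jump ((refine p c ^^ L) g) \<le> jump g / 2"
proof -
  \<comment> \<open>Chosen so that the number of indices in \<open>near\<close>, times
    \<open>e\<close>, times their largest distance from the centre is one half.\<close>
  define e where "e = 1 / (2 * (real (4 * p + 9) * real (2 * p + 4)))"
  have e: "e > 0" "real (4 * p + 9) * (e * real (2 * p + 4)) = 1 / 2"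
    unfolding e_def by (simp_all del: of_nat_add of_nat_mult add: field_simps)
  from eventually_impulse_step_small[OF e(1)] obtain L
    where L: "\<And>n. \<bar>impulse p c L (n + 1) - impulse p c L n\<bar> \<le> e"
    unfolding eventually_sequentially by blast
  have "jump ((refine p c ^^ L) g) \<le> jump g / 2" if g: "bounded (range g)" for g :: "int \<Rightarrow> 'b"
  proof (rule jump_le)
    fix n
    define x where "x = real_of_int n / 2 ^ L"
    let ?d = "\<lambda>j. impulse p c L (n + 1 - 2 ^ L * j) - impulse p c L (n - 2 ^ L * j)"
    have near: "\<bar>real_of_int n / 2 ^ L - x\<bar> \<le> 1" "\<bar>real_of_int (n + 1) / 2 ^ L - x\<bar> \<le> 1"
      unfolding x_def by (simp_all add: add_divide_distrib)
    have rep: "(refine p c ^^ L) h (n + 1) - (refine p c ^^ L) h n = (\<Sum>j\<in>near p x. ?d j *\<^sub>R h j)"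
      for h :: "int \<Rightarrow> 'b"
      unfolding refine_pow_eq_sum_near[OF near(1)] refine_pow_eq_sum_near[OF near(2)]
      by (simp only: scaleR_diff_left sum_subtractf)
    \<comment> \<open>\<open>rep\<close> for a constant sequence, which the rounds leave
      unchanged.\<close>
    have "(\<Sum>j\<in>near p x. ?d j *\<^sub>R g \<lfloor>x\<rfloor>) = 0"
      unfolding rep[symmetric] by (simp add: refine_pow_const[OF sum_one])
    then have "(refine p c ^^ L) g (n + 1) - (refine p c ^^ L) g n =
        (\<Sum>j\<in>near p x. ?d j *\<^sub>R (g j - g \<lfloor>x\<rfloor>))"
      by (simp only: rep scaleR_diff_right sum_subtractf diff_zero)
    also have "norm \<dots> \<le> (\<Sum>j\<in>near p x. e * (real (2 * p + 4) * jump g))"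
    proof (intro order_trans[OF norm_sum] sum_mono)
      fix j assume "j \<in> near p x"
      from norm_diff_near_le[OF g this] L[of "n - 2 ^ L * j"]
      show "norm (?d j *\<^sub>R (g j - g \<lfloor>x\<rfloor>)) \<le> e * (real (2 * p + 4) * jump g)"
        unfolding norm_scaleR using e(1) by (intro mult_mono) (auto simp: algebra_simps)
    qed
    also have "\<dots> = (real (4 * p + 9) * (e * real (2 * p + 4))) * jump g"
      by (simp only: sum_constant card_near mult.assoc)
    also have "\<dots> = jump g / 2" by (simp only: e(2) mult_1 times_divide_eq_left)
    finally show "norm ((refine p c ^^ L) g (n + 1) - (refine p c ^^ L) g n) \<le> jump g / 2" .
  qed
  then show ?thesis by blast
qed

text \<open>
  If \<open>L\<close> rounds of the linear scheme halve the jump, then \<open>V g = \<Sum>j<L. jump (A^j g)\<close>, with \<open>A\<close> one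
  such round, is a Lyapunov function: \<open>V (A g) \<le> V g - jump g / 2\<close>.
\<close>

lemma summable_jump:
  fixes f :: "nat \<Rightarrow> int \<Rightarrow> 'b::real_normed_vector"
  assumes bdd: "\<And>k. bounded (range (f k))"
    and pert: "\<And>k n. norm (f (Suc k) n - refine p c (f k) n) \<le> \<kappa> / 2 ^ k * jump (f k)"
  shows "summable (\<lambda>k. jump (f k))"
proof -
  obtain L where L: "\<And>g :: int \<Rightarrow> 'b. bounded (range g) \<Longrightarrow> jump ((refine p c ^^ L) g) \<le> jump g / 2"
    using ex_contraction by metis
  define V :: "(int \<Rightarrow> 'b) \<Rightarrow> real" where "V g = (\<Sum>j<L. jump ((refine p c ^^ j) g))" for g
  define Q where "Q = (\<Sum>j<L. 2 * mask_bound p c ^ j)"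
  define E where "E k n = f (Suc k) n - refine p c (f k) n" for k n
  have bddA: "bounded (range (refine p c (f k)))" for k
    using bounded_refine_pow[OF bdd, where p = p and c = c and k = 1] by simp
  have bddE: "bounded (range (E k))" for k
    unfolding E_def by (intro bounded_range_diff bdd bddA)
  have V_nonneg: "0 \<le> V g" if "bounded (range g)" for g
    unfolding V_def by (intro sum_nonneg jump_nonneg bounded_refine_pow that)
  have V_refine: "V (refine p c g) \<le> V g - jump g / 2" if g: "bounded (range g)" for g
  proof -
    \<comment> \<open>Passing from \<open>g\<close> to one round of it drops the summand
      \<open>jump g\<close> and adds the one for \<open>L\<close> rounds, at most half as
      large.\<close>
    have "V (refine p c g) + jump g = (\<Sum>j<L. jump ((refine p c ^^ Suc j) g)) + jump ((refine p c ^^ 0) g)"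
      by (simp add: V_def funpow_swap1)
    also have "\<dots> = (\<Sum>j<Suc L. jump ((refine p c ^^ j) g))"
      by (simp only: sum.lessThan_Suc_shift add.commute)
    also have "\<dots> = V g + jump ((refine p c ^^ L) g)" by (simp add: V_def)
    finally show ?thesis using L[OF g] by linarith
  qed
  have V_E: "V (E k) \<le> Q * (\<kappa> / 2 ^ k * jump (f k))" for k
    unfolding V_def Q_def sum_distrib_right
    by (intro sum_mono jump_refine_pow_le) (simp only: E_def pert)
  have "(\<lambda>k. Q * \<kappa> * (1 / 2 ^ k)) \<longlonglongrightarrow> 0" by real_asymp
  then have "\<forall>\<^sub>F k in sequentially. Q * \<kappa> * (1 / 2 ^ k) < 1 / 4"
    by (rule order_tendstoD) simp
  \<comment> \<open>From \<open>N\<close> on the perturbation raises \<open>V\<close> by at most a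
    quarter of the jump, half of what a linear round gains.\<close>
  then obtain N where N: "\<And>k. N \<le> k \<Longrightarrow> Q * \<kappa> * (1 / 2 ^ k) < 1 / 4"
    unfolding eventually_sequentially by blast
  have descent: "V (f (Suc k)) \<le> V (f k) - jump (f k) / 4" if "N \<le> k" for k
  proof -
    have "f (Suc k) = (\<lambda>n. refine p c (f k) n + E k n)" by (simp add: E_def)
    then have "V (f (Suc k)) \<le> (\<Sum>j<L. jump ((refine p c ^^ j) (refine p c (f k))) + jump ((refine p c ^^ j) (E k)))"
      unfolding V_def refine_pow_add[symmetric]
      by (simp only: refine_pow_add) (intro sum_mono jump_add_le bounded_refine_pow bddA bddE)
    also have "\<dots> = V (refine p c (f k)) + V (E k)"
      by (simp add: V_def sum.distrib)
    also have "\<dots> \<le> (V (f k) - jump (f k) / 2) + 1 / 4 * jump (f k)"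
    proof (rule add_mono[OF V_refine[OF bdd]])
      have "V (E k) \<le> Q * \<kappa> * (1 / 2 ^ k) * jump (f k)" using V_E[of k] by (simp add: mult_ac)
      also have "\<dots> \<le> 1 / 4 * jump (f k)"
        using N[OF that] by (intro mult_right_mono jump_nonneg[OF bdd]) simp
      finally show "V (E k) \<le> 1 / 4 * jump (f k)" .
    qed
    finally show ?thesis by simp
  qed
  \<comment> \<open>The telescoped descent; as \<open>V\<close> is nonnegative, it bounds all
    partial sums by \<open>4 * V (f N)\<close>.\<close>
  have partial: "(\<Sum>k<n. jump (f (k + N))) \<le> 4 * (V (f N) - V (f (n + N)))" for n
  proof (induction n)
    case (Suc n)
    then show ?case using descent[of "n + N"] by simp
  qed simp
  have "summable (\<lambda>k. jump (f (k + N)))"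
  proof (rule summableI_nonneg_bounded)
    show "(\<Sum>k<n. jump (f (k + N))) \<le> 4 * V (f N)" for n
      using partial[of n] V_nonneg[OF bdd, of "n + N"] by simp
  qed (rule jump_nonneg[OF bdd])
  then show ?thesis by (subst (asm) summable_iff_shift)
qed

text \<open>Summable jumps enter twice: they dominate the increments of \<open>F k\<close> and their
  derivatives, giving a smooth limit \<open>G\<close>, and they tend to 0, which brings
  \<open>f k\<close> itself close to the samples of \<open>F k\<close>.\<close>

lemma perturbed_limit:
  fixes f :: "nat \<Rightarrow> int \<Rightarrow> 'b::banach"
  assumes bdd: "\<And>k. bounded (range (f k))" and "0 \<le> \<kappa>"
    and pert: "\<And>k n. norm (f (Suc k) n - refine p c (f k) n) \<le> \<kappa> / 2 ^ k * jump (f k)"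
  shows "\<exists>G. G C1_differentiable_on UNIV \<and>
    (\<forall>e>0. \<forall>\<^sub>F k in sequentially. \<forall>n. norm (f k n - G (real_of_int n / 2 ^ k)) \<le> e)"
proof -
  have sm: "summable (\<lambda>k. jump (f k))" by (rule summable_jump[OF bdd pert])
  obtain K where K: "K > 0" "\<And>x. \<bar>\<phi> x\<bar> \<le> K" using ex_bound by blast
  obtain K' where K': "K' > 0" "\<And>x. \<bar>\<phi>' x\<bar> \<le> K'" using ex_bound_deriv by blast
  define E where "E k n = f (Suc k) n - refine p c (f k) n" for k n
  \<comment> \<open>At \<open>n / 2 ^ k\<close> the argument of \<open>synth\<close> is the integer
    \<open>n\<close>, where \<open>ex_synth_error\<close> compares it with
    \<open>f k n\<close>.\<close>
  define F where "F k x = synth p \<phi> (f k) (2 ^ k * x)" for k x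
  define h where "h k x = synth p \<phi> (E k) (2 ^ Suc k * x)" for k x
  define h' where "h' k x = (2 ^ Suc k :: real) *\<^sub>R synth p \<phi>' (E k) (2 ^ Suc k * x)" for k x
  have E: "norm (E k n) \<le> \<kappa> / 2 ^ k * jump (f k)" for k n
    using pert by (simp add: E_def)
  have F_Suc: "F (Suc k) x = F k x + h k x" for k x
  proof -
    have "h k x = F (Suc k) x - synth p \<phi> (refine p c (f k)) (2 ^ Suc k * x)"
      unfolding h_def F_def synth_diff[symmetric] E_def ..
    also have "2 ^ Suc k * x = 2 * (2 ^ k * x)" by simp
    finally show ?thesis by (simp only: synth_refine F_def) simp
  qed
  have F_sum: "F n x = F 0 x + (\<Sum>i<n. h i x)" for n x
    by (induction n) (simp_all add: F_Suc add.assoc)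
  have h_le: "norm (h k x) \<le> real (4 * p + 9) * (K * \<kappa>) * jump (f k)" for k x
  proof -
    have "norm (h k x) \<le> real (4 * p + 9) * (K * (\<kappa> / 2 ^ k * jump (f k)))"
      unfolding h_def by (rule norm_synth_le[OF K(2) E])
    also have "\<dots> \<le> real (4 * p + 9) * (K * (\<kappa> * jump (f k)))"
    proof (intro mult_left_mono mult_right_mono jump_nonneg[OF bdd])
      show "\<kappa> / 2 ^ k \<le> \<kappa>"
        using \<open>0 \<le> \<kappa>\<close> by (simp add: divide_le_eq mult_left_le_one_le mult_le_cancel_left1)
    qed (use K in auto)
    finally show ?thesis by (simp only: mult.assoc)
  qed
  \<comment> \<open>The decisive balance: the factor \<open>2 ^ Suc k\<close> from the chain rule is
    cancelled, up to 2, by the decay \<open>1 / 2 ^ k\<close> of the perturbation.\<close>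
  have h'_le: "norm (h' k x) \<le> (2 * real (4 * p + 9) * (K' * \<kappa>)) * jump (f k)" for k x
  proof -
    have "norm (h' k x) \<le> 2 ^ Suc k * (real (4 * p + 9) * (K' * (\<kappa> / 2 ^ k * jump (f k))))"
      unfolding h'_def norm_scaleR using norm_synth_le[OF K'(2) E]
      by (intro mult_mono) auto
    also have "\<dots> = (2 * real (4 * p + 9) * (K' * \<kappa>)) * jump (f k)" by simp
    finally show ?thesis .
  qed
  have h_der: "(h k has_vector_derivative h' k x) (at x)" for k x
  proof -
    have "((\<lambda>x. 2 ^ Suc k * x) has_vector_derivative (2 ^ Suc k :: real)) (at x)"
      by (auto intro!: derivative_eq_intros)
    moreover have "(synth p \<phi> (E k) has_vector_derivative synth p \<phi>' (E k) (2 ^ Suc k * x))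
        (at (2 ^ Suc k * x))"
      by (rule has_vector_derivative_synth[OF supp deriv])
    ultimately have "(synth p \<phi> (E k) \<circ> (\<lambda>x. 2 ^ Suc k * x) has_vector_derivative h' k x) (at x)"
      unfolding h'_def by (rule vector_diff_chain_at)
    then show ?thesis by (simp only: h_def[abs_def] o_def)
  qed
  have cont_h': "continuous_on UNIV (h' k)" for k
    unfolding h'_def
    by (intro continuous_intros
        continuous_on_compose2[OF continuous_on_synth[OF supp_deriv cont_deriv]]) auto
  have lim_h: "uniform_limit UNIV (\<lambda>n x. \<Sum>i<n. h i x) (\<lambda>x. \<Sum>i. h i x) sequentially"
    by (rule Weierstrass_m_test[OF h_le]) (intro summable_mult sm)
  have lim_h': "uniform_limit UNIV (\<lambda>n x. \<Sum>i<n. h' i x) (\<lambda>x. \<Sum>i. h' i x) sequentially"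
    by (rule Weierstrass_m_test[OF h'_le]) (intro summable_mult sm)
  define H where "H x = (\<Sum>i. h i x)" for x
  define H' where "H' x = (\<Sum>i. h' i x)" for x
  have cont_H': "continuous_on UNIV H'"
    unfolding H'_def
    by (rule uniform_limit_theorem[OF _ lim_h'])
       (auto intro!: always_eventually continuous_on_sum cont_h')
  \<comment> \<open>Termwise differentiation needs uniform convergence of the derivatives and
    convergence of the series at one point, here 0.\<close>
  have "\<exists>g. \<forall>x\<in>UNIV. (\<lambda>n. h n x) sums g x \<and> (g has_derivative (\<lambda>t. t *\<^sub>R H' x)) (at x within UNIV)"
  proof (rule has_derivative_series)
    show "(h n has_derivative (\<lambda>t. t *\<^sub>R h' n x)) (at x within UNIV)" for n x
      using h_der[of n x] by (simp add: has_vector_derivative_def)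
    show "\<forall>\<^sub>F n in sequentially. \<forall>x\<in>UNIV. \<forall>t. norm ((\<Sum>i<n. t *\<^sub>R h' i x) - t *\<^sub>R H' x) \<le> e * norm t"
      if "0 < e" for e
      using uniform_limitD[OF lim_h' that]
    proof eventually_elim
      case (elim n)
      have "norm ((\<Sum>i<n. t *\<^sub>R h' i x) - t *\<^sub>R H' x) = norm t * norm ((\<Sum>i<n. h' i x) - H' x)" for t x
        by (simp flip: scaleR_sum_right scaleR_diff_right)
      then show ?case using elim unfolding H'_def dist_norm
        by (metis UNIV_I less_imp_le mult.commute mult_right_mono norm_ge_zero)
    qed
    have "summable (\<lambda>n. h n 0)"
      by (rule summable_comparison_test'[OF summable_mult[OF sm] h_le])
    then show "(\<lambda>n. h n 0) sums (\<Sum>n. h n 0)" by (rule summable_sums)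
  qed auto
  \<comment> \<open>The differentiable sum provided is some \<open>g\<close>; uniqueness of sums
    identifies it with \<open>H\<close>.\<close>
  then have H_der: "(H has_vector_derivative H' x) (at x)" for x
    by (metis UNIV_I H_def has_vector_derivative_def sums_unique ext)
  define G where "G x = F 0 x + H x" for x
  have F_0: "F 0 = synth p \<phi> (f 0)" by (simp add: F_def fun_eq_iff)
  have "(G has_vector_derivative (synth p \<phi>' (f 0) x + H' x)) (at x)" for x
    unfolding G_def F_0
    by (intro has_vector_derivative_add H_der has_vector_derivative_synth[OF supp deriv])
  moreover have "continuous_on UNIV (\<lambda>x. synth p \<phi>' (f 0) x + H' x)"
    by (intro continuous_on_add cont_H' continuous_on_synth[OF supp_deriv cont_deriv])
  ultimately have "G C1_differentiable_on UNIV"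
    unfolding C1_differentiable_on_def
    by (intro exI[of _ "\<lambda>x. synth p \<phi>' (f 0) x + H' x"] conjI ballI)
  moreover have "\<forall>\<^sub>F k in sequentially. \<forall>n. norm (f k n - G (real_of_int n / 2 ^ k)) \<le> e"
    if "0 < e" for e
  proof -
    obtain B where "B > 0"
      and B: "\<And>(g :: int \<Rightarrow> 'b) n. bounded (range g) \<Longrightarrow> norm (g n - synth p \<phi> g (real_of_int n)) \<le> B * jump g"
      using ex_synth_error by metis
    have "(\<lambda>k. B * jump (f k)) \<longlonglongrightarrow> B * 0"
      by (intro tendsto_intros summable_LIMSEQ_zero sm)
    then have "\<forall>\<^sub>F k in sequentially. B * jump (f k) < e / 2"
      using that by (intro order_tendstoD) auto
    moreover have "\<forall>\<^sub>F k in sequentially. \<forall>x\<in>UNIV. dist (\<Sum>i<k. h i x) (\<Sum>i. h i x) < e / 2"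
      using that by (intro uniform_limitD[OF lim_h]) simp
    ultimately show ?thesis
    proof eventually_elim
      case (elim k)
      show ?case
      proof
        fix n
        let ?x = "real_of_int n / 2 ^ k"
        have "F k ?x - G ?x = (\<Sum>i<k. h i ?x) - (\<Sum>i. h i ?x)"
          unfolding F_sum[of k] G_def H_def by simp
        then have "norm (F k ?x - G ?x) < e / 2"
          using elim(2) by (simp add: dist_norm)
        moreover have "norm (f k n - F k ?x) \<le> B * jump (f k)"
          using B[OF bdd, of k n] by (simp add: F_def)
        moreover have "norm (f k n - G ?x) \<le> norm (f k n - F k ?x) + norm (F k ?x - G ?x)"
          by (metis diff_add_cancel diff_diff_eq2 norm_triangle_ineq add_diff_eq)
        ultimately show "norm (f k n - G ?x) \<le> e" using elim(1) by linarith
      qed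
    qed
  qed
  ultimately show ?thesis by blast
qed

end

subsection \<open>Limit functions\<close>

text \<open>Trades the supremum in \<open>ennreal\<close> for an epsilon statement and the condition
  on \<open>i\<close> for one on the dyadic point \<open>i / 2 ^ k\<close>.\<close>

lemma converges_uniformly_iff:
  "converges_uniformly fs G \<longleftrightarrow> (\<forall>a b. a \<le> b \<longrightarrow> (\<forall>e>0. \<forall>\<^sub>F k in sequentially. \<forall>i.
     a \<le> real_of_int i / 2 ^ k \<and> real_of_int i / 2 ^ k \<le> b \<longrightarrow>
     norm (fs k i - G (real_of_int i / 2 ^ k)) \<le> e))"
proof -
  have set_eq: "{i. real_of_int i \<in> (\<lambda>x. 2 ^ k * x) ` {a..b}} =
      {i. a \<le> real_of_int i / 2 ^ k \<and> real_of_int i / 2 ^ k \<le> b}" for k :: nat and a b :: real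
  proof -
    have "real_of_int i \<in> (\<lambda>x. 2 ^ k * x) ` {a..b} \<longleftrightarrow> real_of_int i / 2 ^ k \<in> {a..b}" for i
    proof
      assume "real_of_int i / 2 ^ k \<in> {a..b}"
      then show "real_of_int i \<in> (\<lambda>x. 2 ^ k * x) ` {a..b}"
        by (intro image_eqI[where x = "real_of_int i / 2 ^ k"]) auto
    qed (auto simp: field_simps)
    then show ?thesis by simp
  qed
  have "((\<lambda>k. SUP i\<in>I k. ennreal (d k i)) \<longlonglongrightarrow> 0) \<longleftrightarrow>
      (\<forall>e>0. \<forall>\<^sub>F k in sequentially. \<forall>i\<in>I k. d k i \<le> e)"
    for I :: "nat \<Rightarrow> int set" and d :: "nat \<Rightarrow> int \<Rightarrow> real"
  proof (intro iffI allI impI)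
    fix e :: real
    assume lim: "(\<lambda>k. SUP i\<in>I k. ennreal (d k i)) \<longlonglongrightarrow> 0" and "0 < e"
    then have "\<forall>\<^sub>F k in sequentially. (SUP i\<in>I k. ennreal (d k i)) < ennreal e"
      by (intro order_tendstoD) auto
    then show "\<forall>\<^sub>F k in sequentially. \<forall>i\<in>I k. d k i \<le> e"
    proof eventually_elim
      case (elim k)
      show ?case
      proof
        fix i assume "i \<in> I k"
        then have "ennreal (d k i) < ennreal e" using elim by (meson SUP_upper le_less_trans)
        then show "d k i \<le> e" using \<open>0 < e\<close> by (meson ennreal_leI leD le_cases)
      qed
    qed
  next
    assume small: "\<forall>e>0. \<forall>\<^sub>F k in sequentially. \<forall>i\<in>I k. d k i \<le> e"
    show "(\<lambda>k. SUP i\<in>I k. ennreal (d k i)) \<longlonglongrightarrow> 0"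
    proof (rule order_tendstoI)
      fix y :: ennreal assume "0 < y"
      \<comment> \<open>A value strictly between 0 and \<open>y\<close> is finite even for infinite
        \<open>y\<close>, and leaves room for the strict inequality after taking the
        supremum.\<close>
      then obtain z where z: "0 < z" "z < y" using dense by blast
      then obtain e where e: "z = ennreal e" "0 < e" by (cases z) auto
      from small e(2) have "\<forall>\<^sub>F k in sequentially. \<forall>i\<in>I k. d k i \<le> e" by blast
      then show "\<forall>\<^sub>F k in sequentially. (SUP i\<in>I k. ennreal (d k i)) < y"
      proof eventually_elim
        case (elim k)
        then have "(SUP i\<in>I k. ennreal (d k i)) \<le> z"
          unfolding e(1) by (intro SUP_least ennreal_leI) auto
        with z(2) show ?case by simp
      qed
    qed auto
  qed
  then show ?thesis
    unfolding converges_uniformly_def set_eq by simp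
qed

text \<open>The dyadic points \<open>\<lfloor>2 ^ k * x\<rfloor> / 2 ^ k\<close> tend to
  \<open>x\<close> and stay in one compact interval, so uniform convergence there and continuity of
  \<open>G\<close> recover its value at \<open>x\<close>.\<close>

lemma limit_function_tendsto:
  assumes "limit_function S f G"
  shows "(\<lambda>k. iterates S f k \<lfloor>2 ^ k * x\<rfloor>) \<longlonglongrightarrow> G x"
proof -
  let ?y = "\<lambda>k. real_of_int \<lfloor>2 ^ k * x\<rfloor> / 2 ^ k"
  have conv: "converges_uniformly (iterates S f) G" and cont: "continuous_on UNIV G"
    using assms by (simp_all add: limit_function_def)
  have d: "\<bar>?y k - x\<bar> \<le> 1 / 2 ^ k" for k by (rule floor_dyadic_diff)
  have "(\<lambda>k. 1 / 2 ^ k :: real) \<longlonglongrightarrow> 0" by real_asymp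
  then have "(\<lambda>k. ?y k - x) \<longlonglongrightarrow> 0"
    by (rule Lim_null_comparison[rotated]) (simp add: d)
  then have "?y \<longlonglongrightarrow> x" by (simp only: LIM_zero_iff)
  then have 1: "(\<lambda>k. G (?y k)) \<longlonglongrightarrow> G x"
    by (rule isCont_tendsto_compose[rotated]) (use cont in \<open>simp add: continuous_on_eq_continuous_at\<close>)
  have y: "x - 1 \<le> ?y k \<and> ?y k \<le> x + 1" for k
  proof -
    have "1 / 2 ^ k \<le> (1 :: real)" by simp
    with d[of k] show ?thesis by linarith
  qed
  have 2: "(\<lambda>k. iterates S f k \<lfloor>2 ^ k * x\<rfloor> - G (?y k)) \<longlonglongrightarrow> 0"
  proof (rule tendstoI)
    fix e :: real assume "0 < e"
    then have "\<forall>\<^sub>F k in sequentially. \<forall>i.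
        x - 1 \<le> real_of_int i / 2 ^ k \<and> real_of_int i / 2 ^ k \<le> x + 1 \<longrightarrow>
        norm (iterates S f k i - G (real_of_int i / 2 ^ k)) \<le> e / 2"
      using conv[unfolded converges_uniformly_iff, rule_format, of "x - 1" "x + 1" "e / 2"] by simp
    then show "\<forall>\<^sub>F k in sequentially. dist (iterates S f k \<lfloor>2 ^ k * x\<rfloor> - G (?y k)) 0 < e"
    proof eventually_elim
      case (elim k)
      then have "norm (iterates S f k \<lfloor>2 ^ k * x\<rfloor> - G (?y k)) \<le> e / 2" using y by blast
      then show ?case using \<open>0 < e\<close> unfolding dist_norm diff_zero by linarith
    qed
  qed
  from tendsto_add[OF 2 1] show ?thesis by simp
qed

lemma limit_function_unique:
  assumes "limit_function S f G" "limit_function S f H"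
  shows "G = H"
  using limit_function_tendsto[OF assms(1)] limit_function_tendsto[OF assms(2)] LIMSEQ_unique
  by blast

section \<open>The basic limit function of a smooth linear scheme\<close>

lemma refine_pow_scaleR:
  "(refine p c ^^ k) (\<lambda>i. x i *\<^sub>R v) = (\<lambda>n. (refine p c ^^ k) x n *\<^sub>R v)"
  by (induction k) (simp_all add: refine_def scaleR_sum_left del: sum.lessThan_Suc fun_eq_iff)

text \<open>The linear scheme acts on each coordinate by the same scalar rules. Started from the
  impulse times a unit vector, it yields \<phi> as one component of the limit.\<close>

lemma C1_refinable_linear_scheme:
  fixes a :: "nat \<Rightarrow> real Matrix.vec"
  assumes a: "\<And>l. l < 2 \<Longrightarrow> a l \<in> carrier_vec (2 * p + 2)"
    and ones: "\<And>l. l < 2 \<Longrightarrow> (\<Sum>t<2 * p + 2. vec_index (a l) t) = 1"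
    and C1: "C1_scheme (linear_scheme p a :: nat \<Rightarrow> (int \<Rightarrow> real^'n) \<Rightarrow> int \<Rightarrow> real^'n)"
  shows "\<exists>\<phi> \<phi>'. C1_refinable p (\<lambda>l. vec_index (a l)) \<phi> \<phi>'"
proof -
  let ?c = "\<lambda>l. vec_index (a l)"
  let ?S = "linear_scheme p a :: nat \<Rightarrow> (int \<Rightarrow> real^'n) \<Rightarrow> int \<Rightarrow> real^'n"
  obtain m :: 'n where True by blast
  define v :: "real^'n" where "v = axis m 1"
  define \<delta> :: "int \<Rightarrow> real^'n" where "\<delta> i = (if i = 0 then 1 else 0 :: real) *\<^sub>R v" for i
  have vm: "v $ m = 1" by (simp add: v_def)
  have "\<delta> \<in> linf"
    unfolding linf_def bounded_iff by (auto intro!: exI[of _ "norm v"] simp: \<delta>_def)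
  then obtain G where G: "limit_function ?S \<delta> G" and "G C1_differentiable_on UNIV"
    using C1 unfolding C1_scheme_def convergent_scheme_def by blast
  then obtain D where D: "\<And>x. (G has_vector_derivative D x) (at x)" and contD: "continuous_on UNIV D"
    unfolding C1_differentiable_on_def by auto
  have iter: "iterates ?S \<delta> k n = impulse p ?c k n *\<^sub>R v" for k n
  proof -
    have "iterates ?S \<delta> k = (refine p ?c ^^ k) \<delta>"
      by (induction k) (simp_all add: linear_scheme_eq_refine[OF a])
    then show ?thesis unfolding impulse_def \<delta>_def refine_pow_scaleR by simp
  qed
  define \<phi> where "\<phi> x = G x $ m" for x
  have supp: "\<phi> x = 0" if x: "real (2 * p + 2) < \<bar>x\<bar>" for x
  proof -
    \<comment> \<open>Rounding down still leaves absolute value at least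
      \<open>(2 * p + 2) * 2 ^ k\<close>, strictly beyond the support radius with
      \<open>2 ^ k - 1\<close>.\<close>
    have "impulse p ?c k \<lfloor>2 ^ k * x\<rfloor> = 0" for k
    proof (rule impulse_eq_0)
      define N :: int where "N = int (2 * p + 2) * 2 ^ k"
      have N: "real_of_int N = real (2 * p + 2) * 2 ^ k" by (simp add: N_def)
      have "real (2 * p + 2) * 2 ^ k < \<bar>x\<bar> * 2 ^ k"
        by (rule mult_strict_right_mono[OF x]) simp
      then have "real_of_int N < \<bar>2 ^ k * x\<bar>" by (simp add: N abs_mult mult.commute)
      then have "N \<le> \<bar>\<lfloor>2 ^ k * x\<rfloor>\<bar>" by linarith
      moreover have "int (2 * p + 2) * (2 ^ k - 1) < N" by (simp add: N_def algebra_simps)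
      ultimately show "int (2 * p + 2) * (2 ^ k - 1) < \<bar>\<lfloor>2 ^ k * x\<rfloor>\<bar>" by linarith
    qed
    with limit_function_tendsto[OF G, of x] have "(\<lambda>k. 0) \<longlonglongrightarrow> G x"
      by (simp add: iter)
    then have "G x = 0" by (simp add: LIMSEQ_const_iff)
    then show ?thesis by (simp add: \<phi>_def)
  qed
  have "C1_refinable p ?c \<phi> (\<lambda>x. D x $ m)"
  proof
    show "(\<Sum>t<2 * p + 2. ?c l t) = 1" if "l < 2" for l by (rule ones[OF that])
    show "\<phi> x = 0" if "real (2 * p + 2) < \<bar>x\<bar>" for x by (rule supp[OF that])
    show "(\<phi> has_real_derivative D x $ m) (at x)" for x
      using bounded_linear.has_vector_derivative[OF bounded_linear_vec_nth D, of m x]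
      by (simp add: has_real_derivative_iff_has_vector_derivative \<phi>_def[abs_def])
    show "continuous_on UNIV (\<lambda>x. D x $ m)"
      by (intro continuous_intros contD)
    fix e :: real assume "0 < e"
    let ?R = "real (2 * p + 2)"
    have "\<forall>\<^sub>F k in sequentially. \<forall>i. - ?R \<le> real_of_int i / 2 ^ k \<and> real_of_int i / 2 ^ k \<le> ?R \<longrightarrow>
        norm (iterates ?S \<delta> k i - G (real_of_int i / 2 ^ k)) \<le> e"
    proof -
      have "converges_uniformly (iterates ?S \<delta>) G" using G by (simp add: limit_function_def)
      moreover have "- ?R \<le> ?R" by simp
      ultimately show ?thesis using \<open>0 < e\<close> unfolding converges_uniformly_iff by blast
    qed
    then show "\<forall>\<^sub>F k in sequentially. \<forall>n. \<bar>impulse p ?c k n - \<phi> (real_of_int n / 2 ^ k)\<bar> \<le> e"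
    proof eventually_elim
      case (elim k)
      show ?case
      proof
        fix n :: int
        let ?x = "real_of_int n / 2 ^ k"
        show "\<bar>impulse p ?c k n - \<phi> ?x\<bar> \<le> e"
        \<comment> \<open>Convergence is given on compact intervals only. Outside the support
          interval both terms vanish, so the estimate extends to all \<open>n\<close>.\<close>
        proof (cases "?R < \<bar>?x\<bar>")
          case True
          then have "real (2 * p + 2) * 2 ^ k < \<bar>real_of_int n\<bar>"
            by (simp add: pos_less_divide_eq)
          then have "real_of_int (int (2 * p + 2) * 2 ^ k) < real_of_int \<bar>n\<bar>" by simp
          then have "int (2 * p + 2) * 2 ^ k < \<bar>n\<bar>" by (simp only: of_int_less_iff)
          moreover have "int (2 * p + 2) * (2 ^ k - 1) < int (2 * p + 2) * 2 ^ k"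
            by (simp add: algebra_simps)
          ultimately have "impulse p ?c k n = 0" by (intro impulse_eq_0) linarith
          with True supp \<open>0 < e\<close> show ?thesis by simp
        next
          case False
          then have "norm (impulse p ?c k n *\<^sub>R v - G ?x) \<le> e"
            using elim[rule_format, of n] unfolding iter by linarith
          with component_le_norm_cart[of "impulse p ?c k n *\<^sub>R v - G ?x" m]
          show ?thesis by (simp add: vm \<phi>_def)
        qed
      qed
    qed
  qed
  then show ?thesis by blast
qed

section \<open>Constants, smooth limits and nontriviality of the nonlinear scheme\<close>

theorem theorem33:
  fixes S :: "nat \<Rightarrow> (int \<Rightarrow> real^'n) \<Rightarrow> int \<Rightarrow> real^'n"
    and \<Psi> :: "nat \<Rightarrow> nat \<Rightarrow> (real^'n) Matrix.vec \<Rightarrow> real^'n"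
    and \<pi> :: "nat \<Rightarrow> (real^'n) Matrix.vec \<Rightarrow> real Matrix.vec"
    and \<Lambda> :: "nat \<Rightarrow> real Matrix.vec \<Rightarrow> real Matrix.vec"
    and D :: "real Matrix.vec set"
    and p q :: nat and \<rho> C :: real
  assumes "class_B p \<Psi> q D \<pi> \<Lambda> \<rho> C S"
    and "\<forall>x\<in>D. \<forall>l<2. pairing (\<Lambda> l x) (Matrix.vec (2 * p + 2) (\<lambda>j. 1 :: real)) = 1"
  shows "reproduces_constants S \<and>
    (C1_scheme (linear_scheme p (\<lambda>l. \<Lambda> l (0\<^sub>v q)) :: nat \<Rightarrow> (int \<Rightarrow> real^'n) \<Rightarrow> int \<Rightarrow> real^'n)
      \<longrightarrow> C1_scheme S)"
proof (intro conjI impI)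
  let ?a = "\<lambda>l. \<Lambda> l (0\<^sub>v q)"
  let ?c = "\<lambda>l. vec_index (\<Lambda> l (0\<^sub>v q))"
  have carr: "?a l \<in> carrier_vec (2 * p + 2)" if "l < 2" for l
    using assms(1) that unfolding class_B_def by blast
  have sum_one: "(\<Sum>t<2 * p + 2. ?c l t) = 1" if "l < 2" for l
  proof -
    have "0\<^sub>v q \<in> D" using assms(1) unfolding class_B_def by blast
    with assms(2) that show ?thesis by (simp only: pairing_ones[OF carr[OF that], symmetric])
  qed
  have linf: "S k f \<in> linf" if "f \<in> linf" for k f
    using assms(1) that unfolding class_B_def uniform_scheme_def by blast
  have iter_linf: "iterates S f k \<in> linf" if "f \<in> linf" for k f
    by (induction k) (simp_all add: that linf)
  have const_linf: "(\<lambda>i. v) \<in> linf" for v :: "real^'n"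
    by (simp add: linf_def)
  from class_B_perturbation[OF assms] obtain \<kappa> where "0 \<le> \<kappa>"
    and \<kappa>: "\<And>k f n. f \<in> linf \<Longrightarrow> norm (S k f n - refine p ?c f n) \<le> \<kappa> / 2 ^ k * jump f"
    by blast
  \<comment> \<open>A constant has jump 0, so on it the perturbation estimate forces
    \<open>S k\<close> to agree with the linear scheme.\<close>
  have S_const: "S k (\<lambda>i. v) = (\<lambda>i. v)" for k v
  proof
    fix n
    have "jump (\<lambda>i. v) \<le> 0" by (rule jump_le) simp
    then have "\<kappa> / 2 ^ k * jump (\<lambda>i. v) \<le> 0"
      using \<open>0 \<le> \<kappa>\<close> by (intro mult_nonneg_nonpos) auto
    with \<kappa>[OF const_linf, of k v n] have "norm (S k (\<lambda>i. v) n - refine p ?c (\<lambda>i. v) n) \<le> 0"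
      by linarith
    then show "S k (\<lambda>i. v) n = v" by (simp add: refine_const[OF sum_one])
  qed
  have iter_const: "iterates S (\<lambda>i. v) k = (\<lambda>i. v)" for k v
    by (induction k) (simp_all add: S_const)
  then show "reproduces_constants S" unfolding reproduces_constants_def by blast
  assume C1: "C1_scheme (linear_scheme p ?a :: nat \<Rightarrow> (int \<Rightarrow> real^'n) \<Rightarrow> int \<Rightarrow> real^'n)"
  obtain \<phi> \<phi>' where "C1_refinable p ?c \<phi> \<phi>'"
    using C1_refinable_linear_scheme[OF carr sum_one C1] by blast
  then interpret C1_refinable p ?c \<phi> \<phi>' .
  have lim: "\<exists>G. G C1_differentiable_on UNIV \<and> limit_function S f G" if f: "f \<in> linf" for f
  proof -
    have "\<exists>G. G C1_differentiable_on UNIV \<and> (\<forall>e>0. \<forall>\<^sub>F k in sequentially.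
        \<forall>n. norm (iterates S f k n - G (real_of_int n / 2 ^ k)) \<le> e)"
    proof (rule perturbed_limit[OF _ \<open>0 \<le> \<kappa>\<close>])
      show "bounded (range (iterates S f k))" for k
        using iter_linf[OF f] by (simp add: linf_def)
      show "norm (iterates S f (Suc k) n - refine p ?c (iterates S f k) n) \<le>
          \<kappa> / 2 ^ k * jump (iterates S f k)" for k n
        using \<kappa>[OF iter_linf[OF f]] by simp
    qed
    then obtain G where G: "G C1_differentiable_on UNIV"
      and conv: "\<And>e. e > 0 \<Longrightarrow> \<forall>\<^sub>F k in sequentially.
        \<forall>n. norm (iterates S f k n - G (real_of_int n / 2 ^ k)) \<le> e" by blast
    have "converges_uniformly (iterates S f) G"
      unfolding converges_uniformly_iff
    proof (intro allI impI)
      fix a b e :: real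
      assume "0 < e"
      from conv[OF this] show "\<forall>\<^sub>F k in sequentially. \<forall>i.
          a \<le> real_of_int i / 2 ^ k \<and> real_of_int i / 2 ^ k \<le> b \<longrightarrow>
          norm (iterates S f k i - G (real_of_int i / 2 ^ k)) \<le> e"
        by eventually_elim blast
    qed
    moreover have "continuous_on UNIV G"
      using G by (rule C1_differentiable_imp_continuous_on)
    ultimately show ?thesis using G unfolding limit_function_def by blast
  qed
  \<comment> \<open>Reproduction of constants makes a nonzero constant its own limit, so the limit
    operator is not zero.\<close>
  have "\<exists>f\<in>linf. \<exists>G. limit_function S f G \<and> G \<noteq> (\<lambda>x. 0)"
  proof (intro bexI exI conjI)
    let ?v = "1 :: real^'n"
    show "(\<lambda>i. ?v) \<in> linf" by (rule const_linf)
    show "limit_function S (\<lambda>i. ?v) (\<lambda>x. ?v)"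
      by (simp add: limit_function_def converges_uniformly_iff iter_const)
    show "(\<lambda>x :: real. ?v) \<noteq> (\<lambda>x. 0)" by (simp add: fun_eq_iff)
  qed
  \<comment> \<open>Smoothness is demanded of every limit function; uniqueness transfers it from the
    one constructed.\<close>
  then show "C1_scheme S"
    unfolding C1_scheme_def convergent_scheme_def
    using lim limit_function_unique by metis
qed

end
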